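(* Let $T>0$ and let $b,\sigma$ satisfy conditions (a), (b) of the context. For a grid point $a=t_m=mh$ and $y\in\mathbb{R}^d$, let $Y^h_t$ be the interpolated Euler process started from $y$ at time $a$, and for $t\in(a,T]$ let $$G_t=\int_a^t(D_rY^h_t)^T(D_rY^h_t)\,dr\in\mathbb{R}^{d\times d}$$ be its Malliavin matrix. There exists $h_0>0$ such that for all $h\le h_0$ and any $p>1$, $$\mathbb{E}|G_t^{-1}|^p\le C(t-a)^{-p},$$ where $C$ is independent of $h$ and $a,t$ (it may depend on $h_0,T,p$).
   Context: Setting. $W$ is a standard $m$-dimensional Brownian motion, $b:\mathbb{R}_+\times\mathbb{R}^d\to\mathbb{R}^d$, $\sigma:\mathbb{R}_+\times\mathbb{R}^d\to\mathbb{R}^{d\times m}$, $\Lambda(t,x)=\sigma(t,x)\sigma(t,x)^T$. Conditions on the coefficients: there are constants $L,C>0$, $q\ge0$, $\kappa>0$ such that (a) $b\in C^3(\mathbb{R}_+\times\mathbb{R}^d;\mathbb{R}^d)$; $|b(t,x_1)-b(t,x_2)|\le L|x_1-x_2|$ for all $t\ge0$; $|b(t_1,x)-b(t_2,x)|\le L|t_2-t_1|(1+|x|^q)$; $\sup_{t\ge0}|\partial_x^\alpha b(t,x)|\le C(1+|x|^q)$ for $2\le|\alpha|\le3$. (b) $\sigma\in C^3(\mathbb{R}_+\times\mathbb{R}^d;\mathbb{R}^{d\times m})$; $|\sigma(t,x_1)-\sigma(t,x_2)|\le L|x_1-x_2|$ for all $t\ge0$; $\sup_{t\ge0}|\partial_x^\alpha\sigma(t,x)|<C(1+|x|^q)$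 for $2\le|\alpha|\le3$; $\Lambda(t,x)-\kappa I$ is positive semidefinite for all $(t,x)$; and $|\Lambda(t_1,x)-\Lambda(t_2,x)|+|\nabla_x\cdot\Lambda(t_1,x)-\nabla_x\cdot\Lambda(t_2,x)|\le L|t_2-t_1|(1+|x|^q)$. Interpolated Euler process: with time step $h>0$, $t_k=kh$, $\lfloor s\rfloor:=h[s/h]$ ($[\cdot]$ the integer part), $$Y^h_t=y+\int_a^t b(\lfloor s\rfloor,Y^h_{\lfloor s\rfloor})\,ds+\int_a^t\sigma(\lfloor s\rfloor,Y^h_{\lfloor s\rfloor})\,dW_s,\quad t\ge a.$$ $D_r$ is the Malliavin derivative with respect to $W$; $D_rY^h_t\in\mathbb{R}^{m\times d}$ with $j$-th column the Malliavin derivative of the $j$-th component $(Y^h_t)^j$. Equivalently, $D_rY^h_t=0$ for $r>t$ and, for $t\in(t_{n-1},t_n]$ with $t>a$, $D_rY^h_t=\sigma(t_{n-1},Y^h_{t_{n-1}})^T$ for $r\in(t_{n-1},t]$ and $D_rY^h_t=D_rY^h_{t_{n-1}}F_t$ for $a\le r\le t_{n-1}$, where $(F_t)_{ij}=\delta_{ij}+\partial_{x_i}b^j(t_{n-1},Y^h_{t_{n-1}})(t-t_{n-1})+\sum_{\ell=1}^m\partial_{x_i}\sigma^{j\ell}(t_{n-1},Y^h_{t_{n-1}})(W^\ell_t-W^\ell_{t_{n-1}})$. $|\cdot|$ is the spectral norm. *)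

theory Defs
  imports "HOL-Probability.Probability"
begin

section \<open>Matrices\<close>

text \<open>A matrix with \<open>d\<close> rows and \<open>m\<close> columns has type \<open>real ^ 'm ^ 'd\<close>.  The norm that the
  library puts on this type is the Frobenius norm, so the spectral norm needs a name of its own.\<close>

definition spectral_norm :: "real ^ 'n ^ 'k \<Rightarrow> real" where
  "spectral_norm A = onorm (\<lambda>v. A *v v)"

definition psd :: "real ^ 'n ^ 'n \<Rightarrow> bool" where
  "psd A \<longleftrightarrow> transpose A = A \<and> (\<forall>v. 0 \<le> v \<bullet> (A *v v))"

section \<open>Regularity of the coefficients\<close>

text \<open>Continuous differentiability of order \<open>k\<close> on \<open>S\<close>.  It is used on the closed half space
  \<open>{0..} \<times> UNIV\<close>, where the derivative within the set is unique and is one-sided in time on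
  the boundary.\<close>

primrec C_on :: "nat \<Rightarrow> ('a::euclidean_space) set \<Rightarrow> ('a \<Rightarrow> 'b::real_normed_vector) \<Rightarrow> bool" where
  "C_on 0 S f \<longleftrightarrow> continuous_on S f"
| "C_on (Suc k) S f \<longleftrightarrow>
     (\<exists>f'. (\<forall>z\<in>S. (f has_derivative f' z) (at z within S)) \<and> (\<forall>e\<in>Basis. C_on k S (\<lambda>z. f' z e)))"

definition partial_x :: "'d \<Rightarrow> (real \<Rightarrow> real ^ 'd \<Rightarrow> 'b::real_normed_vector) \<Rightarrow> real \<Rightarrow> real ^ 'd \<Rightarrow> 'b" where
  "partial_x i f t x = vector_derivative (\<lambda>s. f t (x + s *\<^sub>R axis i 1)) (at 0)"

text \<open>A multi-index \<open>\<alpha>\<close> is given by a list of coordinates, whose length is \<open>|\<alpha>|\<close>.\<close>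

primrec partials_x :: "'d list \<Rightarrow> (real \<Rightarrow> real ^ 'd \<Rightarrow> 'b::real_normed_vector) \<Rightarrow> real \<Rightarrow> real ^ 'd \<Rightarrow> 'b" where
  "partials_x [] f = f"
| "partials_x (i # \<alpha>) f = partial_x i (partials_x \<alpha> f)"

text \<open>\<open>1 + |x| ^ q\<close> for real \<open>q \<ge> 0\<close>; the case distinction is needed because
  \<open>0 powr 0 = 0\<close> in the library.\<close>

definition growth :: "real \<Rightarrow> real ^ 'd \<Rightarrow> real" where
  "growth q x = 1 + (if q = 0 then 1 else norm x powr q)"

definition diffusion_matrix :: "(real \<Rightarrow> real ^ 'd \<Rightarrow> real ^ 'm ^ 'd) \<Rightarrow> real \<Rightarrow> real ^ 'd \<Rightarrow> real ^ 'd ^ 'd" where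
  "diffusion_matrix \<sigma> t x = \<sigma> t x ** transpose (\<sigma> t x)"

definition divergence_x :: "(real \<Rightarrow> real ^ 'd \<Rightarrow> real ^ 'd ^ 'd) \<Rightarrow> real \<Rightarrow> real ^ 'd \<Rightarrow> real ^ 'd" where
  "divergence_x A t x = (\<chi> i. \<Sum>j\<in>UNIV. partial_x j A t x $ i $ j)"

definition drift_condition ::
    "real \<Rightarrow> real \<Rightarrow> real \<Rightarrow> (real \<Rightarrow> real ^ 'd \<Rightarrow> real ^ 'd) \<Rightarrow> bool" where
  "drift_condition L C q b \<longleftrightarrow>
     C_on 3 ({0..} \<times> UNIV) (\<lambda>(t, x). b t x) \<and>
     (\<forall>t\<ge>0. \<forall>x1 x2. norm (b t x1 - b t x2) \<le> L * norm (x1 - x2)) \<and>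
     (\<forall>t1\<ge>0. \<forall>t2\<ge>0. \<forall>x. norm (b t1 x - b t2 x) \<le> L * \<bar>t2 - t1\<bar> * growth q x) \<and>
     (\<forall>\<alpha> x. 2 \<le> length \<alpha> \<and> length \<alpha> \<le> 3 \<longrightarrow>
        (SUP t\<in>{0..}. ereal (norm (partials_x \<alpha> b t x))) \<le> ereal (C * growth q x))"

definition diffusion_condition ::
    "real \<Rightarrow> real \<Rightarrow> real \<Rightarrow> real \<Rightarrow> (real \<Rightarrow> real ^ 'd \<Rightarrow> real ^ 'm ^ 'd) \<Rightarrow> bool" where
  "diffusion_condition L C q \<kappa> \<sigma> \<longleftrightarrow>
     C_on 3 ({0..} \<times> UNIV) (\<lambda>(t, x). \<sigma> t x) \<and>
     (\<forall>t\<ge>0. \<forall>x1 x2. spectral_norm (\<sigma> t x1 - \<sigma> t x2) \<le> L * norm (x1 - x2)) \<and>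
     (\<forall>\<alpha> x. 2 \<le> length \<alpha> \<and> length \<alpha> \<le> 3 \<longrightarrow>
        (SUP t\<in>{0..}. ereal (spectral_norm (partials_x \<alpha> \<sigma> t x))) < ereal (C * growth q x)) \<and>
     (\<forall>t\<ge>0. \<forall>x. psd (diffusion_matrix \<sigma> t x - \<kappa> *\<^sub>R mat 1)) \<and>
     (\<forall>t1\<ge>0. \<forall>t2\<ge>0. \<forall>x.
        spectral_norm (diffusion_matrix \<sigma> t1 x - diffusion_matrix \<sigma> t2 x)
          + norm (divergence_x (diffusion_matrix \<sigma>) t1 x - divergence_x (diffusion_matrix \<sigma>) t2 x)
        \<le> L * \<bar>t2 - t1\<bar> * growth q x)"

section \<open>Brownian motion\<close>

definition std_brownian_motion :: "'w measure \<Rightarrow> (real \<Rightarrow> 'w \<Rightarrow> real ^ 'm) \<Rightarrow> bool" where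
  "std_brownian_motion M W \<longleftrightarrow>
     prob_space M \<and>
     (\<forall>t\<ge>0. W t \<in> borel_measurable M) \<and>
     (AE \<omega> in M. W 0 \<omega> = 0) \<and>
     (AE \<omega> in M. continuous_on {0..} (\<lambda>t. W t \<omega>)) \<and>
     (\<forall>(s :: nat \<Rightarrow> real) n. 0 \<le> s 0 \<and> mono s \<longrightarrow>
        prob_space.indep_vars M (\<lambda>_. borel) (\<lambda>i \<omega>. W (s (Suc i)) \<omega> - W (s i) \<omega>) {..<n}) \<and>
     (\<forall>s t. 0 \<le> s \<and> s < t \<longrightarrow>
        prob_space.indep_vars M (\<lambda>_. borel) (\<lambda>l \<omega>. W t \<omega> $ l - W s \<omega> $ l) UNIV \<and>
        (\<forall>l. distributed M lborel (\<lambda>\<omega>. W t \<omega> $ l - W s \<omega> $ l)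
               (normal_density 0 (sqrt (t - s)))))"

section \<open>The interpolated Euler process\<close>

definition grid_floor :: "real \<Rightarrow> real \<Rightarrow> real" where
  "grid_floor h s = h * of_int \<lfloor>s / h\<rfloor>"

text \<open>The stochastic integral of the step process \<open>H (grid_floor h s)\<close> over \<open>[m h, t]\<close>, that is,
  the elementary Ito integral, which is defined path by path.\<close>

definition step_integral ::
    "real \<Rightarrow> nat \<Rightarrow> (real \<Rightarrow> real ^ 'm ^ 'd) \<Rightarrow> (real \<Rightarrow> real ^ 'm) \<Rightarrow> real \<Rightarrow> real ^ 'd" where
  "step_integral h m H w t =
     (\<Sum>k | m \<le> k \<and> real k * h < t.
        H (real k * h) *v (w (min t (real (Suc k) * h)) - w (real k * h)))"

definition euler_path ::
    "(real \<Rightarrow> real ^ 'd \<Rightarrow> real ^ 'd) \<Rightarrow> (real \<Rightarrow> real ^ 'd \<Rightarrow> real ^ 'm ^ 'd) \<Rightarrow> real \<Rightarrow> nat \<Rightarrow> real ^ 'd \<Rightarrow>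
     (real \<Rightarrow> real ^ 'm) \<Rightarrow> (real \<Rightarrow> real ^ 'd) \<Rightarrow> bool" where
  "euler_path b \<sigma> h m y w Y \<longleftrightarrow>
     (\<forall>t\<ge>real m * h.
        (\<lambda>s. b (grid_floor h s) (Y (grid_floor h s))) integrable_on {real m * h..t} \<and>
        Y t = y + integral {real m * h..t} (\<lambda>s. b (grid_floor h s) (Y (grid_floor h s)))
                + step_integral h m (\<lambda>s. \<sigma> s (Y s)) w t)"

definition euler_process ::
    "'w measure \<Rightarrow> (real \<Rightarrow> 'w \<Rightarrow> real ^ 'm) \<Rightarrow>
     (real \<Rightarrow> real ^ 'd \<Rightarrow> real ^ 'd) \<Rightarrow> (real \<Rightarrow> real ^ 'd \<Rightarrow> real ^ 'm ^ 'd) \<Rightarrow> real \<Rightarrow> nat \<Rightarrow> real ^ 'd \<Rightarrow>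
     (real \<Rightarrow> 'w \<Rightarrow> real ^ 'd) \<Rightarrow> bool" where
  "euler_process M W b \<sigma> h m y Y \<longleftrightarrow>
     (\<forall>t\<ge>real m * h. Y t \<in> borel_measurable M) \<and>
     (AE \<omega> in M. euler_path b \<sigma> h m y (\<lambda>t. W t \<omega>) (\<lambda>t. Y t \<omega>))"

section \<open>Its Malliavin derivative\<close>

text \<open>\<open>euler_F b \<sigma> h w Y n t\<close> is the matrix \<open>F\<^sub>t\<close> for \<open>t \<in> (n h, (n + 1) h]\<close>; its \<open>(i, j)\<close> entry is
  the derivative of the \<open>j\<close>-th component of the Euler step in the direction \<open>i\<close>.\<close>

definition euler_F ::
    "(real \<Rightarrow> real ^ 'd \<Rightarrow> real ^ 'd) \<Rightarrow> (real \<Rightarrow> real ^ 'd \<Rightarrow> real ^ 'm ^ 'd) \<Rightarrow> real \<Rightarrow>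
     (real \<Rightarrow> real ^ 'm) \<Rightarrow> (real \<Rightarrow> real ^ 'd) \<Rightarrow> nat \<Rightarrow> real \<Rightarrow> real ^ 'd ^ 'd" where
  "euler_F b \<sigma> h w Y n t =
     (let s = real n * h in
      \<chi> i j. (if i = j then 1 else 0) + partial_x i b s (Y s) $ j * (t - s)
        + (\<Sum>l\<in>UNIV. partial_x i \<sigma> s (Y s) $ j $ l * (w t $ l - w s $ l)))"

text \<open>\<open>malliavin_step b \<sigma> h m w Y r n t\<close> is \<open>D\<^sub>r Y\<^sub>t\<close> for \<open>t\<close> in the \<open>n\<close>-th interval \<open>((n - 1) h, n h]\<close>.
  It is \<open>0\<close> for \<open>n \<le> m\<close>, because the process starts at time \<open>m h\<close> from a deterministic point.\<close>

primrec malliavin_step ::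
    "(real \<Rightarrow> real ^ 'd \<Rightarrow> real ^ 'd) \<Rightarrow> (real \<Rightarrow> real ^ 'd \<Rightarrow> real ^ 'm ^ 'd) \<Rightarrow> real \<Rightarrow> nat \<Rightarrow>
     (real \<Rightarrow> real ^ 'm) \<Rightarrow> (real \<Rightarrow> real ^ 'd) \<Rightarrow> real \<Rightarrow> nat \<Rightarrow> real \<Rightarrow> real ^ 'd ^ 'm" where
  "malliavin_step b \<sigma> h m w Y r 0 t = 0"
| "malliavin_step b \<sigma> h m w Y r (Suc n) t =
     (if n < m \<or> r > t then 0
      else if r > real n * h then transpose (\<sigma> (real n * h) (Y (real n * h)))
      else malliavin_step b \<sigma> h m w Y r n (real n * h) ** euler_F b \<sigma> h w Y n t)"

definition malliavin_euler ::
    "(real \<Rightarrow> real ^ 'd \<Rightarrow> real ^ 'd) \<Rightarrow> (real \<Rightarrow> real ^ 'd \<Rightarrow> real ^ 'm ^ 'd) \<Rightarrow> real \<Rightarrow> nat \<Rightarrow>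
     (real \<Rightarrow> real ^ 'm) \<Rightarrow> (real \<Rightarrow> real ^ 'd) \<Rightarrow> real \<Rightarrow> real \<Rightarrow> real ^ 'd ^ 'm" where
  "malliavin_euler b \<sigma> h m w Y r t = malliavin_step b \<sigma> h m w Y r (nat \<lceil>t / h\<rceil>) t"

definition malliavin_matrix ::
    "(real \<Rightarrow> real ^ 'd \<Rightarrow> real ^ 'd) \<Rightarrow> (real \<Rightarrow> real ^ 'd \<Rightarrow> real ^ 'm ^ 'd) \<Rightarrow> real \<Rightarrow> nat \<Rightarrow>
     (real \<Rightarrow> real ^ 'm) \<Rightarrow> (real \<Rightarrow> real ^ 'd) \<Rightarrow> real \<Rightarrow> real ^ 'd ^ 'd" where
  "malliavin_matrix b \<sigma> h m w Y t =
     integral {real m * h..t}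
       (\<lambda>r. transpose (malliavin_euler b \<sigma> h m w Y r t) ** malliavin_euler b \<sigma> h m w Y r t)"

text \<open>The clauses that characterise the derivative.\<close>

lemma malliavin_euler_eq:
  assumes h: "0 < h" and n: "m \<le> n" and t: "real n * h < t" "t \<le> real (Suc n) * h"
  shows malliavin_euler_conv_step: "malliavin_euler b \<sigma> h m w Y r t = malliavin_step b \<sigma> h m w Y r (Suc n) t"
    and "r > t \<Longrightarrow> malliavin_euler b \<sigma> h m w Y r t = 0"
    and "real n * h < r \<Longrightarrow> r \<le> t \<Longrightarrow>
           malliavin_euler b \<sigma> h m w Y r t = transpose (\<sigma> (real n * h) (Y (real n * h)))"
    and "m < n \<Longrightarrow> r \<le> real n * h \<Longrightarrow>
           malliavin_euler b \<sigma> h m w Y r t =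
             malliavin_euler b \<sigma> h m w Y r (real n * h) ** euler_F b \<sigma> h w Y n t"
proof -
  have "real n < t / h" "t / h \<le> real (Suc n)"
    using h t by (simp_all add: field_simps)
  then have "\<lceil>t / h\<rceil> = int (Suc n)"
    by (intro ceiling_unique) auto
  then show *: "malliavin_euler b \<sigma> h m w Y r t = malliavin_step b \<sigma> h m w Y r (Suc n) t"
    by (simp add: malliavin_euler_def nat_add_distrib)
  show "r > t \<Longrightarrow> malliavin_euler b \<sigma> h m w Y r t = 0"
    unfolding * by simp
  show "real n * h < r \<Longrightarrow> r \<le> t \<Longrightarrow>
           malliavin_euler b \<sigma> h m w Y r t = transpose (\<sigma> (real n * h) (Y (real n * h)))"
    using n unfolding * by simp
  show "m < n \<Longrightarrow> r \<le> real n * h \<Longrightarrow>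
           malliavin_euler b \<sigma> h m w Y r t =
             malliavin_euler b \<sigma> h m w Y r (real n * h) ** euler_F b \<sigma> h w Y n t"
    using n h t unfolding * by (simp add: malliavin_euler_def)
qed

lemma grid_floor_eq:
  assumes "0 < h" "real n * h \<le> s" "s < real (Suc n) * h"
  shows "grid_floor h s = real n * h"
proof -
  have "real n \<le> s / h" "s / h < real (Suc n)"
    using assms by (simp_all add: field_simps)
  then have "\<lfloor>s / h\<rfloor> = int n"
    by (intro floor_unique) auto
  then show ?thesis by (simp add: grid_floor_def)
qed

lemma euler_path_start:
  assumes "0 < h" "euler_path b \<sigma> h m y w Y"
  shows "Y (real m * h) = y"
proof -
  have "{k. m \<le> k \<and> real k * h < real m * h} = {}"
    using assms(1) by auto
  then have "step_integral h m (\<lambda>s. \<sigma> s (Y s)) w (real m * h) = 0"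
    unfolding step_integral_def by (simp only: sum.empty)
  moreover have "Y (real m * h) = y + integral {real m * h..real m * h} (\<lambda>s. b (grid_floor h s) (Y (grid_floor h s)))
                + step_integral h m (\<lambda>s. \<sigma> s (Y s)) w (real m * h)"
    using assms(2) unfolding euler_path_def by blast
  ultimately show ?thesis by simp
qed

lemma euler_path_step:
  assumes h: "0 < h" and Y: "euler_path b \<sigma> h m y w Y"
    and n: "m \<le> n" and t: "real n * h < t" "t \<le> real (Suc n) * h"
  shows "Y t = Y (real n * h) + (t - real n * h) *\<^sub>R b (real n * h) (Y (real n * h))
               + \<sigma> (real n * h) (Y (real n * h)) *v (w t - w (real n * h))"
proof -
  define s where "s = real n * h"
  define f where "f = (\<lambda>s. b (grid_floor h s) (Y (grid_floor h s)))"
  have ms: "real m * h \<le> s" "s < t" using n h t by (auto simp: s_def)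
  have f_int: "f integrable_on {real m * h..t}"
    and Yt: "Y t = y + integral {real m * h..t} f + step_integral h m (\<lambda>s. \<sigma> s (Y s)) w t"
    using Y ms unfolding euler_path_def f_def by auto
  have Ys: "Y s = y + integral {real m * h..s} f + step_integral h m (\<lambda>s. \<sigma> s (Y s)) w s"
    using Y ms unfolding euler_path_def f_def by auto
  have b1: "((\<lambda>_. b s (Y s)) has_integral (t - s) *\<^sub>R b s (Y s)) {s..t}"
    using has_integral_const_real[of "b s (Y s)" s t] ms by simp
  have b2: "f r = b s (Y s)" if "r \<in> {s..t} - {t}" for r
    using that t grid_floor_eq[OF h, of n r] by (simp add: f_def s_def)
  have "(f has_integral (t - s) *\<^sub>R b s (Y s)) {s..t}"
  proof (rule has_integral_spike_finite)
    show "finite {t}" by (rule finite.intros)+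
    show "((\<lambda>_. b s (Y s)) has_integral (t - s) *\<^sub>R b s (Y s)) {s..t}" by (rule b1)
    show "f r = b s (Y s)" if "r \<in> {s..t} - {t}" for r using that by (rule b2)
  qed
  then have "integral {s..t} f = (t - s) *\<^sub>R b s (Y s)"
    by (rule integral_unique)
  then have I: "integral {real m * h..t} f = integral {real m * h..s} f + (t - s) *\<^sub>R b s (Y s)"
    using Henstock_Kurzweil_Integration.integral_combine[of "real m * h" s t f] ms f_int by simp
  have k_le: "real k * h < s \<longleftrightarrow> k < n" for k
    using h by (simp add: s_def)
  have k_lt: "real k * h < t \<longleftrightarrow> k \<le> n" for k
  proof
    assume "real k * h < t"
    then have "real k * h < real (Suc n) * h"
      using t(2) by (rule less_le_trans)
    then have "real k < real (Suc n)"
      using h by (simp only: mult_less_cancel_right_pos)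
    then show "k \<le> n" by linarith
  next
    assume "k \<le> n"
    then have "real k * h \<le> real n * h"
      using h by (intro mult_right_mono) auto
    then show "real k * h < t"
      using t(1) by (rule le_less_trans)
  qed
  have K: "{k. m \<le> k \<and> real k * h < t} = insert n {k. m \<le> k \<and> k < n}"
    unfolding k_lt using n by auto
  have mins: "min s (real (Suc k) * h) = real (Suc k) * h"
    and mint: "min t (real (Suc k) * h) = real (Suc k) * h" if "k < n" for k
  proof -
    have "real (Suc k) * h \<le> s"
      unfolding s_def using that h by (intro mult_right_mono) linarith+
    then show "min s (real (Suc k) * h) = real (Suc k) * h"
      and "min t (real (Suc k) * h) = real (Suc k) * h"
      using ms by auto
  qed
  let ?S = "\<lambda>u. \<Sum>k | m \<le> k \<and> k < n.
        \<sigma> (real k * h) (Y (real k * h)) *v (w (min u (real (Suc k) * h)) - w (real k * h))"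
  have "?S t = ?S s"
    by (rule sum.cong[OF refl]) (simp only: mem_Collect_eq mins mint)
  moreover have "step_integral h m (\<lambda>s. \<sigma> s (Y s)) w s = ?S s"
    unfolding step_integral_def k_le ..
  moreover have "step_integral h m (\<lambda>s. \<sigma> s (Y s)) w t = \<sigma> s (Y s) *v (w t - w s) + ?S t"
  proof -
    have "min t (real (Suc n) * h) = t" using t by simp
    then show ?thesis
      unfolding step_integral_def K by (subst sum.insert) (simp_all only: s_def, simp_all)
  qed
  ultimately have "step_integral h m (\<lambda>s. \<sigma> s (Y s)) w t =
        step_integral h m (\<lambda>s. \<sigma> s (Y s)) w s + \<sigma> s (Y s) *v (w t - w s)"
    by (simp only: add.commute)
  then show ?thesis
    using Yt Ys I by (simp add: s_def)
qed

lemma has_derivative_partial_x: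
  assumes "(f s has_derivative D) (at x)"
  shows "D v = (\<Sum>i\<in>UNIV. v $ i *\<^sub>R partial_x i f s x)"
proof -
  interpret D: bounded_linear D
    using assms by (rule has_derivative_bounded_linear)
  have "partial_x i f s x = D (axis i 1)" for i
  proof -
    have "((\<lambda>r. x + r *\<^sub>R axis i 1) has_vector_derivative axis i 1) (at 0)"
      by (auto intro!: derivative_eq_intros)
    moreover have "(f s has_derivative D) (at (x + 0 *\<^sub>R axis i 1) within range (\<lambda>r. x + r *\<^sub>R axis i 1))"
      using assms by (simp add: has_derivative_at_withinI)
    ultimately have "((f s \<circ> (\<lambda>r. x + r *\<^sub>R axis i 1)) has_vector_derivative D (axis i 1)) (at 0)"
      by (auto intro: vector_derivative_diff_chain_within)
    then show ?thesis
      unfolding partial_x_def by (intro vector_derivative_at) (simp add: o_def)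
  qed
  moreover have "v = (\<Sum>i\<in>UNIV. v $ i *\<^sub>R axis i 1)"
    by (simp add: basis_expansion flip: scalar_mult_eq_scaleR)
  then have "D v = (\<Sum>i\<in>UNIV. v $ i *\<^sub>R D (axis i 1))"
    by (metis (no_types, lifting) D.scaleR D.sum sum.cong)
  ultimately show ?thesis by simp
qed

lemma bounded_bilinear_matrix_vector:
  "bounded_bilinear (\<lambda>(A :: real ^ 'n ^ 'k) v. A *v v)"
  by (subst bilinear_conv_bounded_bilinear[symmetric])
     (auto simp: bilinear_def linear_iff matrix_vector_mult_add_rdistrib matrix_vector_right_distrib
        scaleR_matrix_vector_assoc matrix_vector_mult_scaleR)

text \<open>The recursion does compute the Malliavin derivative: if the driving path is shifted by
  \<open>\<epsilon>\<close> times the Cameron-Martin path with density \<open>g\<close>, then the derivative of \<open>Y\<^sub>t\<close> at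
  \<open>\<epsilon> = 0\<close> is the integral of \<open>(D\<^sub>r Y\<^sub>t)\<^sup>T g(r)\<close>.\<close>

theorem malliavin_euler_directional_derivative:
  fixes g :: "real \<Rightarrow> real ^ 'm" and \<sigma> :: "real \<Rightarrow> real ^ 'd \<Rightarrow> real ^ 'm ^ 'd"
  assumes h: "0 < h"
    and b: "\<And>s x. 0 \<le> s \<Longrightarrow> b s differentiable (at x)"
    and \<sigma>: "\<And>s x. 0 \<le> s \<Longrightarrow> \<sigma> s differentiable (at x)"
    and g: "\<And>s. 0 \<le> s \<Longrightarrow> g integrable_on {0..s}"
    and Y: "\<And>\<epsilon>. euler_path b \<sigma> h m y (\<lambda>s. w s + \<epsilon> *\<^sub>R integral {0..s} g) (Y \<epsilon>)"
    and t: "real m * h < t"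
  obtains Z where
    "((\<lambda>r. transpose (malliavin_euler b \<sigma> h m w (Y 0) r t) *v g r) has_integral Z) {real m * h..t}"
    "((\<lambda>\<epsilon>. Y \<epsilon> t) has_vector_derivative Z) (at 0)"
proof -
  let ?D = "malliavin_step b \<sigma> h m w (Y 0)"
  let ?P = "\<lambda>n t Z. ((\<lambda>r. transpose (?D r n t) *v g r) has_integral Z) {real m * h..t} \<and>
                    ((\<lambda>\<epsilon>. Y \<epsilon> t) has_vector_derivative Z) (at 0)"
  have grid_step: "\<exists>Z'. ?P (Suc n) t Z'"
    if n: "m \<le> n" and t: "real n * h < t" "t \<le> real (Suc n) * h" and Z: "?P n (real n * h) Z"
    for n t Z
  proof -
    define s where "s = real n * h"
    define J where "J = integral {s..t} g"
    define x where "x = Y 0 s"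
    define F where "F = euler_F b \<sigma> h w (Y 0) n t"
    have s: "0 \<le> s" "real m * h \<le> s" "s < t" using n h t by (auto simp: s_def)
    define Z' where "Z' = transpose F *v Z + \<sigma> s x *v J"
    have g_st: "g integrable_on {s..t}"
      using g[of t] s by (auto intro: integrable_on_subinterval)
    have w: "w t + \<epsilon> *\<^sub>R integral {0..t} g - (w s + \<epsilon> *\<^sub>R integral {0..s} g) = w t - w s + \<epsilon> *\<^sub>R J" for \<epsilon>
    proof -
      have "integral {0..s} g + J = integral {0..t} g"
        unfolding J_def using s g[of t]
        by (intro Henstock_Kurzweil_Integration.integral_combine) auto
      then show ?thesis by (simp add: algebra_simps flip: scaleR_add_right)
    qed
    have Yt: "Y \<epsilon> t = Y \<epsilon> s + (t - s) *\<^sub>R b s (Y \<epsilon> s) + \<sigma> s (Y \<epsilon> s) *v (w t - w s + \<epsilon> *\<^sub>R J)" for \<epsilon>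
      using euler_path_step[OF h Y n t, of \<epsilon>] by (simp add: w flip: s_def)
    obtain Db where Db: "(b s has_derivative Db) (at x)"
      using b[OF s(1)] by (auto simp: differentiable_def)
    obtain Ds where Ds: "(\<sigma> s has_derivative Ds) (at x)"
      using \<sigma>[OF s(1)] by (auto simp: differentiable_def)
    have Ys: "((\<lambda>\<epsilon>. Y \<epsilon> s) has_vector_derivative Z) (at 0)"
      using Z by (simp add: s_def)
    have "(b s \<circ> (\<lambda>\<epsilon>. Y \<epsilon> s) has_vector_derivative Db Z) (at 0)"
      using Ys Db by (intro vector_derivative_diff_chain_within) (auto simp: x_def intro: has_derivative_at_withinI)
    then have bY: "((\<lambda>\<epsilon>. b s (Y \<epsilon> s)) has_vector_derivative Db Z) (at 0)"
      by (simp add: o_def)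
    have "(\<sigma> s \<circ> (\<lambda>\<epsilon>. Y \<epsilon> s) has_vector_derivative Ds Z) (at 0)"
      using Ys Ds by (intro vector_derivative_diff_chain_within) (auto simp: x_def intro: has_derivative_at_withinI)
    then have sY: "((\<lambda>\<epsilon>. \<sigma> s (Y \<epsilon> s)) has_vector_derivative Ds Z) (at 0)"
      by (simp add: o_def)
    have wJ: "((\<lambda>\<epsilon>. w t - w s + \<epsilon> *\<^sub>R J) has_vector_derivative J) (at 0)"
      by (auto intro!: derivative_eq_intros)
    have "((\<lambda>\<epsilon>. \<sigma> s (Y \<epsilon> s) *v (w t - w s + \<epsilon> *\<^sub>R J)) has_vector_derivative
             \<sigma> s x *v J + Ds Z *v (w t - w s)) (at 0)"
      using bounded_bilinear.has_vector_derivative[OF bounded_bilinear_matrix_vector sY wJ]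
      by (simp add: x_def)
    then have dV: "((\<lambda>\<epsilon>. Y \<epsilon> t) has_vector_derivative
             Z + (t - s) *\<^sub>R Db Z + (\<sigma> s x *v J + Ds Z *v (w t - w s))) (at 0)" (is "(_ has_vector_derivative ?V) _")
      unfolding Yt
      by (intro has_vector_derivative_add Ys
          bounded_linear.has_vector_derivative[OF bounded_linear_scaleR_right] bY)
    have FZ: "Z + (t - s) *\<^sub>R Db Z + Ds Z *v (w t - w s) = transpose F *v Z"
    proof (rule vec_eq_iff[THEN iffD2], rule allI)
      fix j
      have "(Ds Z *v (w t - w s)) $ j =
          (\<Sum>l\<in>UNIV. \<Sum>i\<in>UNIV. Z $ i * partial_x i \<sigma> s x $ j $ l * (w t $ l - w s $ l))"
        unfolding has_derivative_partial_x[where f=\<sigma>, OF Ds]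
        by (simp add: matrix_vector_mult_def sum_distrib_right)
      also have "\<dots> = (\<Sum>i\<in>UNIV. \<Sum>l\<in>UNIV. Z $ i * partial_x i \<sigma> s x $ j $ l * (w t $ l - w s $ l))"
        by (rule sum.swap)
      finally have 1: "(Ds Z *v (w t - w s)) $ j = \<dots>" .
      have 2: "Db Z $ j = (\<Sum>i\<in>UNIV. Z $ i * partial_x i b s x $ j)"
        unfolding has_derivative_partial_x[where f=b, OF Db] by simp
      have "(transpose F *v Z) $ j =
          (\<Sum>i\<in>UNIV. ((if i = j then 1 else 0) + partial_x i b s x $ j * (t - s)
             + (\<Sum>l\<in>UNIV. partial_x i \<sigma> s x $ j $ l * (w t $ l - w s $ l))) * Z $ i)"
        by (simp add: matrix_vector_mult_def transpose_def F_def euler_F_def Let_def flip: s_def x_def)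
      also have "\<dots> = (\<Sum>i\<in>UNIV. (if i = j then Z $ i else 0)
          + (t - s) * (Z $ i * partial_x i b s x $ j)
          + (\<Sum>l\<in>UNIV. Z $ i * partial_x i \<sigma> s x $ j $ l * (w t $ l - w s $ l)))"
      proof (intro sum.cong refl)
        fix i
        have "(\<Sum>l\<in>UNIV. Z $ i * partial_x i \<sigma> s x $ j $ l * (w t $ l - w s $ l)) =
            Z $ i * (\<Sum>l\<in>UNIV. partial_x i \<sigma> s x $ j $ l * (w t $ l - w s $ l))"
          by (simp only: sum_distrib_left mult.assoc)
        moreover have "((if i = j then 1 else 0) + p * \<tau> + S) * z =
            (if i = j then z else 0) + \<tau> * (z * p) + z * S" for p \<tau> S z :: real
          by (simp add: algebra_simps)
        ultimately show "((if i = j then 1 else 0) + partial_x i b s x $ j * (t - s)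
             + (\<Sum>l\<in>UNIV. partial_x i \<sigma> s x $ j $ l * (w t $ l - w s $ l))) * Z $ i =
           (if i = j then Z $ i else 0) + (t - s) * (Z $ i * partial_x i b s x $ j)
          + (\<Sum>l\<in>UNIV. Z $ i * partial_x i \<sigma> s x $ j $ l * (w t $ l - w s $ l))"
          by (simp only:)
      qed
      also have "\<dots> = Z $ j + (t - s) * Db Z $ j + (Ds Z *v (w t - w s)) $ j"
        unfolding 1 2 by (simp add: sum.distrib sum_distrib_left)
      finally show "(Z + (t - s) *\<^sub>R Db Z + Ds Z *v (w t - w s)) $ j = (transpose F *v Z) $ j"
        by simp
    qed
    have dY: "((\<lambda>\<epsilon>. Y \<epsilon> t) has_vector_derivative Z') (at 0)"
    proof -
      have "?V = (Z + (t - s) *\<^sub>R Db Z + Ds Z *v (w t - w s)) + \<sigma> s x *v J"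
        by simp
      then have "?V = Z'" by (simp only: FZ Z'_def)
      then show ?thesis using dV by (simp only:)
    qed
    have "((\<lambda>r. transpose F *v (transpose (?D r n s) *v g r)) has_integral transpose F *v Z) {real m * h..s}"
      using has_integral_linear[OF conjunct1[OF Z] matrix_vector_mul_bounded_linear[of "transpose F"]]
      unfolding s_def o_def .
    moreover have "transpose F *v (transpose (?D r n s) *v g r) = transpose (?D r (Suc n) t) *v g r"
      if "r \<in> {real m * h..s}" for r
    proof -
      have "?D r (Suc n) t = ?D r n s ** F"
        using that s n by (simp add: F_def flip: s_def)
      then show ?thesis by (simp only: matrix_transpose_mul matrix_vector_mul_assoc)
    qed
    ultimately have I1: "((\<lambda>r. transpose (?D r (Suc n) t) *v g r) has_integral transpose F *v Z) {real m * h..s}"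
      by (rule has_integral_eq[rotated])
    have g1: "((\<lambda>r. \<sigma> s x *v g r) has_integral \<sigma> s x *v J) {s..t}"
      using has_integral_linear[OF integrable_integral[OF g_st] matrix_vector_mul_bounded_linear[of "\<sigma> s x"]]
      by (simp add: J_def o_def)
    have g2: "transpose (?D r (Suc n) t) *v g r = \<sigma> s x *v g r" if "r \<in> {s..t} - {s}" for r
      using that n by (simp add: transpose_transpose flip: s_def x_def)
    have I2: "((\<lambda>r. transpose (?D r (Suc n) t) *v g r) has_integral \<sigma> s x *v J) {s..t}"
    proof (rule has_integral_spike_finite)
      show "finite {s}" by (rule finite.intros)+
      show "((\<lambda>r. \<sigma> s x *v g r) has_integral \<sigma> s x *v J) {s..t}" by (rule g1)
      show "transpose (?D r (Suc n) t) *v g r = \<sigma> s x *v g r" if "r \<in> {s..t} - {s}" for r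
        using that by (rule g2)
    qed
    have "((\<lambda>r. transpose (?D r (Suc n) t) *v g r) has_integral Z') {real m * h..t}"
      unfolding Z'_def using s by (intro has_integral_combine[OF _ _ I1 I2]) auto
    with dY show ?thesis by blast
  qed
  have grid: "\<exists>Z. ?P n (real n * h) Z" if "m \<le> n" for n
    using that
  proof (induction n rule: dec_induct)
    case base
    have "(\<lambda>\<epsilon>. Y \<epsilon> (real m * h)) = (\<lambda>_. y)"
      using euler_path_start[OF h Y] by auto
    then have "?P m (real m * h) 0"
      by auto
    then show ?case by blast
  next
    case (step n)
    then show ?case
      using grid_step h by force
  qed
  define n where "n = nat (\<lceil>t / h\<rceil> - 1)"
  have "real m < t / h" using t h by (simp add: field_simps)
  then have "int m < \<lceil>t / h\<rceil>" by linarith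
  then have c: "\<lceil>t / h\<rceil> = int (Suc n)" and mn: "m \<le> n" unfolding n_def by linarith+
  then have "real n < t / h" "t / h \<le> real (Suc n)"
    using ceiling_correct[of "t / h"] by auto
  then have tn: "real n * h < t" "t \<le> real (Suc n) * h"
    using h by (simp_all add: field_simps)
  obtain Z where "?P (Suc n) t Z"
    using grid[OF mn] grid_step[OF mn tn] by blast
  then show thesis
    by (intro that[of Z]) (simp_all only: malliavin_euler_conv_step[OF h mn tn])
qed

end

theory Submission
  imports Defs
begin

text \<open>Why the theorem is true.  On \<open>[a, t]\<close> the process makes steps of lengths \<open>\<tau>\<^sub>0, \<dots>, \<tau>\<^sub>n\<^sub>-\<^sub>1\<close>, all equal
  to \<open>h\<close> except perhaps the last, driven by independent Gaussian increments \<open>\<xi>\<^sub>i\<close> of the Brownian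
  motion.  The derivative of one step has the form \<open>F\<^sub>i = 1 + E\<^sub>i\<close>, where \<open>E\<^sub>i\<close> is linear in \<open>\<tau>\<^sub>i\<close> and
  \<open>\<xi>\<^sub>i\<close> with bounded coefficients, because \<open>b\<close> and \<open>\<sigma>\<close> are Lipschitz.  The Malliavin matrix is
  \<open>G = \<Sum>\<^sub>k \<tau>\<^sub>k P\<^sub>k\<^sup>T \<Lambda>\<^sub>k P\<^sub>k\<close> with \<open>P\<^sub>k = F\<^sub>k\<^sub>+\<^sub>1 \<cdots> F\<^sub>n\<^sub>-\<^sub>1\<close> and \<open>\<Lambda>\<^sub>k \<ge> \<kappa>\<close>
  (\<open>malliavin_matrix_eq_gram\<close>).  Its last summand makes \<open>G\<close> invertible, but that step may be
  arbitrarily short, and an \<open>F\<^sub>i\<close> with a large increment may be nearly singular; so the bound has to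
  distinguish two cases (\<open>gram_inverse_power_le\<close>).

  If all increments are at most a fixed \<open>\<epsilon>\<close>, then every \<open>F\<^sub>i\<close> is invertible.  Ellipticity gives
  \<open>G \<ge> \<kappa> \<Sum>\<^sub>k \<tau>\<^sub>k / |R\<^sub>k|\<^sup>2\<close> with \<open>R\<^sub>k = P\<^sub>k\<^sup>-\<^sup>1\<close>, and by convexity
  \<open>|G\<^sup>-\<^sup>1|\<^sup>N\<close> is at most \<open>\<kappa>\<^sup>-\<^sup>N (t - a)\<^sup>-\<^sup>N\<close> times a weighted mean of the \<open>|R\<^sub>k|\<^sup>2\<^sup>N\<close>.  The chain \<open>R\<^sub>k\<close> is
  built from left multiplications by \<open>F\<^sub>i\<^sup>-\<^sup>1\<close>, each independent of the past given the state, and is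
  set to \<open>0\<close> once an increment exceeds \<open>\<epsilon>\<close>.  One step multiplies \<open>E |R\<^sub>k|\<^sup>2\<^sup>N\<close> by at most
  \<open>1 + c \<tau>\<^sub>i\<close>, since the term linear in \<open>\<xi>\<^sub>i\<close> has mean zero; hence these moments are bounded
  (\<open>chain_moment_le\<close>).

  If some increment \<open>\<xi>\<^sub>k\<close> is large, the last or the last but one summand alone gives
  \<open>|G\<^sup>-\<^sup>1| \<le> 4 / (\<kappa> \<tau>\<^sub>k)\<close>.  This is affordable: \<open>\<xi>\<^sub>k\<close> has variance \<open>\<tau>\<^sub>k\<close>, so Markov's inequality for
  its moment of order \<open>2 (N + 1)\<close> bounds the probability by a multiple of \<open>\<tau>\<^sub>k\<^sup>N\<^sup>+\<^sup>1\<close>, and the contributions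
  add up to a multiple of \<open>t - a\<close> (\<open>large_step_le\<close>).  Real exponents are reduced to natural ones by
  \<open>z\<^sup>p \<le> 1 + z\<^sup>N\<close> for \<open>z = (t - a) |G\<^sup>-\<^sup>1|\<close> and \<open>p \<le> N\<close>.\<close>

section \<open>Matrix estimates\<close>

text \<open>The library norm on matrices is the Frobenius norm.  It comes from an inner product, which is
  what the second-order expansion of the moments of the inverse chain needs, and it dominates the
  spectral norm.\<close>

lemma norm_matrix_square: "(norm (A :: real ^ 'n ^ 'k))\<^sup>2 = (\<Sum>i\<in>UNIV. (norm (A $ i))\<^sup>2)"
  by (simp add: norm_vec_def L2_set_def sum_nonneg)

lemma norm_matrix_square_columns:
  "(norm (A :: real ^ 'n ^ 'k))\<^sup>2 = (\<Sum>j\<in>UNIV. (norm (column j A))\<^sup>2)"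
proof -
  have "(norm A)\<^sup>2 = (\<Sum>i\<in>UNIV. \<Sum>j\<in>UNIV. (A $ i $ j)\<^sup>2)"
    by (simp add: norm_vec_def L2_set_def sum_nonneg)
  also have "\<dots> = (\<Sum>j\<in>UNIV. \<Sum>i\<in>UNIV. (A $ i $ j)\<^sup>2)" by (rule sum.swap)
  finally show ?thesis by (simp add: norm_vec_def L2_set_def sum_nonneg column_def)
qed

lemma norm_matrix_vector_le: "norm ((A :: real ^ 'n ^ 'k) *v x) \<le> norm A * norm x"
proof (rule power2_le_imp_le)
  have "(norm (A *v x))\<^sup>2 = (\<Sum>i\<in>UNIV. (A $ i \<bullet> x)\<^sup>2)"
    by (simp add: norm_vec_def L2_set_def sum_nonneg matrix_vector_mul_component)
  also have "\<dots> \<le> (\<Sum>i\<in>UNIV. (norm (A $ i))\<^sup>2 * (norm x)\<^sup>2)"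
    by (intro sum_mono) (metis Cauchy_Schwarz_ineq power2_norm_eq_inner)
  finally show "(norm (A *v x))\<^sup>2 \<le> (norm A * norm x)\<^sup>2"
    by (simp add: power_mult_distrib norm_matrix_square sum_distrib_right)
qed simp

lemma norm_matrix_mult_le:
  "norm ((A :: real ^ 'n ^ 'k) ** (B :: real ^ 'l ^ 'n)) \<le> norm A * norm B"
proof (rule power2_le_imp_le)
  have "column j (A ** B) = A *v column j B" for j
    by (simp add: column_def matrix_matrix_mult_def matrix_vector_mult_def)
  then have "(norm (A ** B))\<^sup>2 = (\<Sum>j\<in>UNIV. (norm (A *v column j B))\<^sup>2)"
    by (simp add: norm_matrix_square_columns[of "A ** B"])
  also have "\<dots> \<le> (\<Sum>j\<in>UNIV. (norm A * norm (column j B))\<^sup>2)"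
    by (intro sum_mono power_mono norm_matrix_vector_le) simp
  finally show "(norm (A ** B))\<^sup>2 \<le> (norm A * norm B)\<^sup>2"
    by (simp add: power_mult_distrib norm_matrix_square_columns[of B] sum_distrib_left)
qed simp

lemma bounded_bilinear_matrix_mult:
  "bounded_bilinear (\<lambda>(A :: real ^ 'n ^ 'k) (B :: real ^ 'l ^ 'n). A ** B)"
proof
  show "(A + A') ** B = A ** B + A' ** B" for A A' :: "real ^ 'n ^ 'k" and B :: "real ^ 'l ^ 'n"
    by (simp add: matrix_matrix_mult_def vec_eq_iff sum.distrib distrib_right)
  show "\<exists>K. \<forall>(A :: real ^ 'n ^ 'k) (B :: real ^ 'l ^ 'n). norm (A ** B) \<le> norm A * norm B * K"
    by (intro exI[of _ 1]) (simp add: norm_matrix_mult_le)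
qed (simp_all add: matrix_matrix_mult_def vec_eq_iff sum.distrib distrib_left sum_distrib_left mult_ac)

lemma norm_matrix_le_entries:
  assumes "\<And>i j. \<bar>(A :: real ^ 'n ^ 'k) $ i $ j\<bar> \<le> c"
  shows "norm A \<le> real CARD('k) * real CARD('n) * c"
proof -
  have row: "norm (A $ i) \<le> real CARD('n) * c" for i
  proof -
    have "norm (A $ i) \<le> (\<Sum>j\<in>UNIV. \<bar>A $ i $ j\<bar>)" by (rule norm_le_l1_cart)
    also have "\<dots> \<le> (\<Sum>j\<in>(UNIV :: 'n set). c)" by (intro sum_mono assms)
    finally show ?thesis by simp
  qed
  have "norm A \<le> (\<Sum>i\<in>UNIV. norm (A $ i))"
    unfolding norm_vec_def by (rule L2_set_le_sum) simp
  also have "\<dots> \<le> (\<Sum>i\<in>(UNIV :: 'k set). real CARD('n) * c)" by (intro sum_mono row)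
  finally show ?thesis by simp
qed

lemma matrix_inv_mult:
  fixes A :: "real ^ 'n ^ 'n"
  assumes "invertible A"
  shows "matrix_inv A ** A = mat 1" and "A ** matrix_inv A = mat 1"
  using someI_ex[OF assms[unfolded invertible_def]] unfolding matrix_inv_def by auto

lemma spectral_norm_inverse_le:
  fixes G :: "real ^ 'n ^ 'n"
  assumes r: "r > 0" and G: "\<And>v. r * (norm v)\<^sup>2 \<le> v \<bullet> (G *v v)"
  shows "invertible G" and "spectral_norm (matrix_inv G) \<le> 1 / r"
proof -
  have below: "r * norm v \<le> norm (G *v v)" for v
  proof (cases "v = 0")
    case False
    have "r * (norm v)\<^sup>2 \<le> norm v * norm (G *v v)"
      using G[of v] norm_cauchy_schwarz[of v "G *v v"] by linarith
    then show ?thesis using False by (simp add: power2_eq_square)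
  qed simp
  have "inj ((*v) G)"
  proof (rule injI)
    fix x y assume "G *v x = G *v y"
    then have "G *v (x - y) = 0" by (simp add: matrix_vector_mult_diff_distrib)
    with below[of "x - y"] r have "norm (x - y) \<le> 0" by (simp add: mult_le_0_iff)
    then show "x = y" by simp
  qed
  then obtain B where "B ** G = mat 1" using matrix_left_invertible_injective by blast
  then show inv: "invertible G" using matrix_left_right_inverse unfolding invertible_def by blast
  show "spectral_norm (matrix_inv G) \<le> 1 / r"
    unfolding spectral_norm_def
  proof (rule onorm_bound)
    fix v
    have "G *v (matrix_inv G *v v) = v"
      by (simp add: matrix_vector_mul_assoc matrix_inv_mult(2)[OF inv])
    with below[of "matrix_inv G *v v"] r show "norm (matrix_inv G *v v) \<le> 1 / r * norm v"
      by (simp add: field_simps)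
  qed (use r in simp)
qed

lemma invertible_mat1_plus:
  fixes E :: "real ^ 'n ^ 'n"
  assumes "norm E \<le> 1 / 2"
  shows "invertible (mat 1 + E)"
proof (rule spectral_norm_inverse_le(1))
  show "(0::real) < 1 / 2" by simp
  fix v :: "real ^ 'n"
  have "\<bar>v \<bullet> (E *v v)\<bar> \<le> norm v * norm (E *v v)" by (rule Cauchy_Schwarz_ineq2)
  also have "\<dots> \<le> norm v * (norm E * norm v)"
    by (intro mult_left_mono norm_matrix_vector_le) simp
  also have "\<dots> \<le> norm v * (1 / 2 * norm v)"
    by (intro mult_left_mono mult_right_mono assms) auto
  finally have "\<bar>v \<bullet> (E *v v)\<bar> \<le> 1 / 2 * (norm v)\<^sup>2" by (simp add: power2_eq_square)
  then show "1 / 2 * (norm v)\<^sup>2 \<le> v \<bullet> ((mat 1 + E) *v v)"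
    by (simp add: matrix_vector_mult_add_rdistrib inner_add_right power2_norm_eq_inner)
qed

text \<open>The range contains the relative change of a squared norm whenever the norm at most
  doubles.  Since \<open>1 + u\<close> is nonnegative, the estimate can be multiplied by it, and \<open>u \<le> 4\<close> turns the
  cubic term into a quadratic one.\<close>

lemma power_le_quadratic:
  fixes u :: real
  assumes "-1 \<le> u" "u \<le> 4"
  shows "(1 + u) ^ N \<le> 1 + real N * u + 6 ^ N * u\<^sup>2"
proof (induction N)
  case (Suc N)
  have "(1 + u) ^ Suc N \<le> (1 + u) * (1 + real N * u + 6 ^ N * u\<^sup>2)"
    using Suc assms by (simp add: mult_left_mono)
  also have "\<dots> = 1 + real (Suc N) * u + (real N + 6 ^ N + 6 ^ N * u) * u\<^sup>2"
    by (simp add: algebra_simps power2_eq_square)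
  also have "\<dots> \<le> 1 + real (Suc N) * u + 6 ^ Suc N * u\<^sup>2"
  proof -
    have "real N \<le> 6 ^ N"
      using of_nat_less_two_power[of N, where 'a=real] power_mono[of "2::real" 6 N] by linarith
    moreover have "6 ^ N * u \<le> 6 ^ N * 4" using assms(2) by (rule mult_left_mono) simp
    ultimately have "real N + 6 ^ N + 6 ^ N * u \<le> 6 ^ Suc N" unfolding power_Suc by linarith
    then show ?thesis by (intro add_left_mono mult_right_mono) auto
  qed
  finally show ?case .
qed simp

text \<open>Here \<open>x' = (1 + E)\<^sup>-\<^sup>1 x\<close> with \<open>|E| \<le> e\<close>.  Up to second order in \<open>e\<close> the vector is \<open>x - E x\<close>, so
  \<open>|x'|\<^sup>2\<close> is \<open>|x|\<^sup>2 - 2 (x \<bullet> E x)\<close> up to \<open>O(e\<^sup>2) |x|\<^sup>2\<close>.  Keeping the first-order term exact matters: it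
  is linear in the noise and disappears in the mean.\<close>

lemma inverse_step_power_le:
  fixes x x' Ex Ex' :: "'a::real_inner"
  assumes N: "N > 0" and e: "0 \<le> e" "e \<le> 1 / 2"
    and eq: "x = x' + Ex'"
    and Ex': "norm Ex' \<le> e * norm x'" and Ex: "norm Ex \<le> e * norm x"
    and lin: "norm (Ex' - Ex) \<le> e * norm (x' - x)"
  shows "norm x' \<le> 2 * norm x" and "norm x' ^ (2 * N) \<le>
    norm x ^ (2 * N) * (1 + (36 * 6 ^ N + 12 * real N) * e\<^sup>2) - 2 * real N * norm x ^ (2 * N - 2) * (x \<bullet> Ex)"
proof -
  define a where "a = norm x"
  define a' where "a' = norm x'"
  have pos: "0 \<le> a" "0 \<le> a'" by (simp_all add: a_def a'_def)
  have "a' - norm Ex' \<le> a"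
    unfolding a_def a'_def eq using norm_triangle_ineq2[of x' "- Ex'"] by simp
  moreover have "norm Ex' \<le> 1 / 2 * a'"
    using Ex' e(2) mult_right_mono[OF e(2), of "norm x'"] by (simp add: a'_def)
  ultimately have a': "a' \<le> 2 * a" by simp
  then show "norm x' \<le> 2 * norm x" by (simp add: a_def a'_def)
  have Ex'2: "norm Ex' \<le> 2 * e * a"
    using Ex' mult_left_mono[OF a' e(1)] by (simp add: a'_def mult_ac)
  have diff: "norm (x' - x) \<le> 2 * e * a"
    using Ex'2 by (simp add: eq)
  have "(x - x') \<bullet> Ex' \<le> 2 * e * a * (2 * e * a)"
    by (rule order_trans[OF norm_cauchy_schwarz]) (intro mult_mono Ex'2, use diff e pos in \<open>auto simp: norm_minus_commute\<close>)
  moreover have "x \<bullet> (Ex - Ex') \<le> a * (e * (2 * e * a))"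
  proof (rule order_trans[OF norm_cauchy_schwarz])
    have "norm (Ex - Ex') \<le> e * (2 * e * a)"
      using lin mult_left_mono[OF diff e(1)] by (simp add: norm_minus_commute)
    then show "norm x * norm (Ex - Ex') \<le> a * (e * (2 * e * a))"
      unfolding a_def by (rule mult_left_mono) simp
  qed
  moreover have "x \<bullet> Ex - x' \<bullet> Ex' = (x - x') \<bullet> Ex' + x \<bullet> (Ex - Ex')"
    by (simp add: algebra_simps)
  ultimately have inner: "x \<bullet> Ex - x' \<bullet> Ex' \<le> 6 * e\<^sup>2 * a\<^sup>2"
    by (simp add: power2_eq_square algebra_simps)
  have "a\<^sup>2 = a'\<^sup>2 + 2 * (x' \<bullet> Ex') + (norm Ex')\<^sup>2"
    unfolding a_def a'_def eq power2_norm_eq_inner by (simp add: algebra_simps inner_commute)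
  then have "a'\<^sup>2 \<le> a\<^sup>2 - 2 * (x' \<bullet> Ex')" by (smt (verit) zero_le_power2)
  with inner have sq: "a'\<^sup>2 - a\<^sup>2 \<le> - 2 * (x \<bullet> Ex) + 12 * e\<^sup>2 * a\<^sup>2" by linarith
  show "norm x' ^ (2 * N) \<le>
    norm x ^ (2 * N) * (1 + (36 * 6 ^ N + 12 * real N) * e\<^sup>2) - 2 * real N * norm x ^ (2 * N - 2) * (x \<bullet> Ex)"
  proof (cases "x = 0")
    case True
    with a' pos N show ?thesis by (simp add: a_def a'_def power_0_left)
  next
    case False
    then have a0: "a > 0" by (simp add: a_def)
    \<comment> \<open>The relative change of the squared norm: it satisfies
      \<open>|x'|\<^sup>2\<^sup>N = |x|\<^sup>2\<^sup>N (1 + u)\<^sup>N\<close>.\<close>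
    define u where "u = (a'\<^sup>2 - a\<^sup>2) / a\<^sup>2"
    have u1: "1 + u = (a' / a)\<^sup>2" using a0 by (simp add: u_def field_simps power_divide)
    have "(a' / a)\<^sup>2 \<le> 4"
      using power_mono[of "a' / a" 2 2] a' a0 pos by (simp add: field_simps)
    then have u_le: "u \<le> 4" "-1 \<le> u" using u1 zero_le_power2[of "a' / a"] by linarith+
    have "\<bar>a' - a\<bar> \<le> 2 * e * a"
      using diff norm_triangle_ineq3[of x' x] by (simp add: a_def a'_def)
    then have "\<bar>a' - a\<bar> * (a' + a) \<le> 2 * e * a * (3 * a)"
      using a' pos e by (intro mult_mono) auto
    moreover have "\<bar>a'\<^sup>2 - a\<^sup>2\<bar> = \<bar>a' - a\<bar> * (a' + a)"
      using pos by (simp add: power2_eq_square square_diff_square_factored abs_mult)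
    ultimately have "\<bar>u\<bar> \<le> 6 * e"
      using a0 by (simp add: u_def abs_divide divide_le_eq power2_eq_square)
    then have "u\<^sup>2 \<le> (6 * e)\<^sup>2" using e abs_le_square_iff[of u "6 * e"] by simp
    then have u2: "6 ^ N * u\<^sup>2 \<le> 6 ^ N * (36 * e\<^sup>2)" by (simp add: power_mult_distrib)
    have "u \<le> (- 2 * (x \<bullet> Ex) + 12 * e\<^sup>2 * a\<^sup>2) / a\<^sup>2"
      unfolding u_def using sq by (intro divide_right_mono) auto
    also have "\<dots> = - 2 * (x \<bullet> Ex) / a\<^sup>2 + 12 * e\<^sup>2"
      using a0 by (simp add: field_simps)
    finally have "real N * u \<le> real N * (- 2 * (x \<bullet> Ex) / a\<^sup>2 + 12 * e\<^sup>2)"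
      by (rule mult_left_mono) simp
    with u2 power_le_quadratic[OF u_le(2,1), of N]
    have "(1 + u) ^ N \<le> 1 + real N * (- 2 * (x \<bullet> Ex) / a\<^sup>2 + 12 * e\<^sup>2) + 6 ^ N * (36 * e\<^sup>2)"
      by linarith
    then have "a ^ (2 * N) * (1 + u) ^ N \<le>
        a ^ (2 * N) * (1 + real N * (- 2 * (x \<bullet> Ex) / a\<^sup>2 + 12 * e\<^sup>2) + 6 ^ N * (36 * e\<^sup>2))"
      using a0 by (intro mult_left_mono) auto
    moreover have "a ^ (2 * N) * (1 + u) ^ N = a' ^ (2 * N)"
      using a0 by (simp add: u1 power_divide power_mult)
    moreover have split: "a ^ (2 * N) = a ^ (2 * N - 2) * a\<^sup>2"
      unfolding power_add[symmetric] using N by (intro arg_cong[where f = "power a"]) simp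
    moreover have "a ^ (2 * N - 2) * a\<^sup>2 * (1 + real N * (- 2 * (x \<bullet> Ex) / a\<^sup>2 + 12 * e\<^sup>2) + 6 ^ N * (36 * e\<^sup>2))
      = a ^ (2 * N - 2) * a\<^sup>2 * (1 + (36 * 6 ^ N + 12 * real N) * e\<^sup>2) - 2 * real N * a ^ (2 * N - 2) * (x \<bullet> Ex)"
      using a0 by (simp add: field_simps)
    ultimately show ?thesis unfolding a_def a'_def by (simp only:)
  qed
qed

section \<open>Gram matrices of products\<close>

primrec gram ::
    "(nat \<Rightarrow> real ^ 'd ^ 'd) \<Rightarrow> (nat \<Rightarrow> real ^ 'd ^ 'd) \<Rightarrow> (nat \<Rightarrow> real) \<Rightarrow> nat \<Rightarrow> real ^ 'd ^ 'd" where
  "gram F A \<tau> 0 = 0"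
| "gram F A \<tau> (Suc n) = transpose (F n) ** gram F A \<tau> n ** F n + \<tau> n *\<^sub>R A n"

text \<open>The product \<open>F\<^sub>n\<^sub>-\<^sub>1\<^sup>-\<^sup>1 \<cdots> F\<^sub>j\<^sup>-\<^sup>1\<close> as long as every step is good.  After a bad step the chain is
  \<open>0\<close>, which keeps its moments finite although \<open>F\<close> may then be arbitrarily close to a singular matrix.\<close>

primrec inverse_chain ::
    "(nat \<Rightarrow> real ^ 'd ^ 'd) \<Rightarrow> (nat \<Rightarrow> bool) \<Rightarrow> nat \<Rightarrow> nat \<Rightarrow> real ^ 'd ^ 'd" where
  "inverse_chain F good j 0 = mat 1"
| "inverse_chain F good j (Suc n) =
     (if n < j then mat 1 else if good n then matrix_inv (F n) ** inverse_chain F good j n else 0)"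

lemma inverse_chain_start: "n \<le> j \<Longrightarrow> inverse_chain F good j n = mat 1"
  by (cases n) auto

lemma gram_form_Suc:
  "v \<bullet> (gram F A \<tau> (Suc n) *v v) =
     (F n *v v) \<bullet> (gram F A \<tau> n *v (F n *v v)) + \<tau> n * (v \<bullet> (A n *v v))"
proof -
  have "v \<bullet> (transpose (F n) ** gram F A \<tau> n ** F n *v v)
      = (F n *v v) \<bullet> (gram F A \<tau> n *v (F n *v v))"
    using dot_lmul_matrix[of v "transpose (F n)" "gram F A \<tau> n *v (F n *v v)"]
    by (simp only: matrix_vector_mul_assoc[symmetric] vector_transpose_matrix)
  then show ?thesis
    by (simp add: matrix_vector_mult_add_rdistrib inner_add_right scaleR_matrix_vector_assoc[symmetric])
qed

context
  fixes F A :: "nat \<Rightarrow> real ^ 'd ^ 'd" and \<tau> :: "nat \<Rightarrow> real" and \<kappa> :: real and n :: nat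
  assumes \<kappa>: "\<kappa> > 0"
    and \<tau>: "\<And>i. i < n \<Longrightarrow> 0 < \<tau> i"
    and A: "\<And>i v. i < n \<Longrightarrow> \<kappa> * (norm v)\<^sup>2 \<le> v \<bullet> (A i *v v)"
begin

lemma gram_form_nonneg: "i \<le> n \<Longrightarrow> 0 \<le> v \<bullet> (gram F A \<tau> i *v v)"
proof (induction i arbitrary: v)
  case (Suc i)
  have "0 \<le> \<kappa> * (norm v)\<^sup>2" using \<kappa> by simp
  also have "\<dots> \<le> v \<bullet> (A i *v v)" using A Suc.prems by simp
  finally have "0 \<le> \<tau> i * (v \<bullet> (A i *v v))"
    using \<tau>[of i] Suc.prems by (simp add: less_imp_le)
  with Suc.IH[of "F i *v v"] Suc.prems show ?case
    unfolding gram_form_Suc by simp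
qed simp

lemma gram_form_ge_last:
  assumes "i < n" shows "\<kappa> * \<tau> i * (norm v)\<^sup>2 \<le> v \<bullet> (gram F A \<tau> (Suc i) *v v)"
proof -
  have "\<tau> i * (\<kappa> * (norm v)\<^sup>2) \<le> \<tau> i * (v \<bullet> (A i *v v))"
    using A[OF assms] \<tau>[OF assms] by (intro mult_left_mono) auto
  with gram_form_nonneg[of i "F i *v v"] assms show ?thesis
    unfolding gram_form_Suc by (simp add: mult_ac)
qed

text \<open>The last step may be much shorter than the others.  This bound trades it for the preceding one,
  at the price of requiring that the last step be good.\<close>

lemma gram_form_ge_penultimate:
  assumes i: "Suc i < n" and F: "norm (F (Suc i) - mat 1) \<le> 1 / 2"
  shows "\<kappa> * \<tau> i / 4 * (norm v)\<^sup>2 \<le> v \<bullet> (gram F A \<tau> (Suc (Suc i)) *v v)"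
proof -
  let ?w = "F (Suc i) *v v"
  have "norm (v - ?w) = norm ((F (Suc i) - mat 1) *v v)"
    by (simp add: matrix_vector_mult_diff_rdistrib norm_minus_commute)
  also have "\<dots> \<le> norm (F (Suc i) - mat 1) * norm v" by (rule norm_matrix_vector_le)
  also have "\<dots> \<le> 1 / 2 * norm v" using F by (intro mult_right_mono) auto
  finally have "norm v \<le> 2 * norm ?w"
    using norm_triangle_ineq2[of v ?w] by linarith
  then have "(norm v)\<^sup>2 \<le> (2 * norm ?w)\<^sup>2" by (rule power_mono) simp
  then have "\<kappa> * \<tau> i * ((norm v)\<^sup>2 / 4) \<le> \<kappa> * \<tau> i * (norm ?w)\<^sup>2"
    using \<kappa> \<tau>[of i] i by (intro mult_left_mono) (auto simp: power_mult_distrib)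
  also have "\<dots> \<le> ?w \<bullet> (gram F A \<tau> (Suc i) *v ?w)" using i by (intro gram_form_ge_last) simp
  also have "\<dots> \<le> v \<bullet> (gram F A \<tau> (Suc (Suc i)) *v v)"
  proof -
    have "0 \<le> \<kappa> * (norm v)\<^sup>2" using \<kappa> by simp
    also have "\<dots> \<le> v \<bullet> (A (Suc i) *v v)" using A i by simp
    finally have "0 \<le> \<tau> (Suc i) * (v \<bullet> (A (Suc i) *v v))"
      using \<tau>[of "Suc i"] i by (simp add: less_imp_le)
    then show ?thesis by (subst (2) gram_form_Suc) simp
  qed
  finally show ?thesis by (simp add: mult_ac)
qed

text \<open>The vectors \<open>u k\<close> are the products \<open>F\<^sub>k\<^sub>+\<^sub>1 \<cdots> F\<^sub>i\<^sub>-\<^sub>1 v\<close>.  They are described by the inverse chain,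
  which is what gives \<open>|v| \<le> |R| |u k|\<close> later.\<close>

lemma gram_form_ge_sum:
  assumes inv: "\<And>i. i < n \<Longrightarrow> good i \<and> invertible (F i)" and i: "i \<le> n"
  shows "\<exists>u. (\<forall>k<i. v = inverse_chain F good (Suc k) i *v u k) \<and>
             \<kappa> * (\<Sum>k<i. \<tau> k * (norm (u k))\<^sup>2) \<le> v \<bullet> (gram F A \<tau> i *v v)"
  using i
proof (induction i arbitrary: v)
  case (Suc i)
  then have i: "i < n" by simp
  obtain u where u: "\<And>k. k < i \<Longrightarrow> F i *v v = inverse_chain F good (Suc k) i *v u k"
    and le: "\<kappa> * (\<Sum>k<i. \<tau> k * (norm (u k))\<^sup>2) \<le> (F i *v v) \<bullet> (gram F A \<tau> i *v (F i *v v))"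
    using Suc.IH[of "F i *v v"] i by auto
  have v: "v = inverse_chain F good (Suc k) (Suc i) *v u k" if "k < i" for k
  proof -
    have "v = matrix_inv (F i) *v (F i *v v)"
      using inv[OF i] by (simp add: matrix_vector_mul_assoc matrix_inv_mult)
    then show ?thesis using that inv[OF i] by (simp add: u[OF that] matrix_vector_mul_assoc)
  qed
  have "\<tau> i * (\<kappa> * (norm v)\<^sup>2) \<le> \<tau> i * (v \<bullet> (A i *v v))"
    using A[OF i] \<tau>[OF i] by (intro mult_left_mono) auto
  with le have "\<kappa> * (\<Sum>k<Suc i. \<tau> k * (norm ((u(i := v)) k))\<^sup>2) \<le> v \<bullet> (gram F A \<tau> (Suc i) *v v)"
    unfolding gram_form_Suc by (simp add: distrib_left mult_ac)
  moreover have "v = inverse_chain F good (Suc k) (Suc i) *v (u(i := v)) k" if "k < Suc i" for k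
    using that v[of k] by (cases "k = i") auto
  ultimately show ?case by blast
qed simp

end

text \<open>Jensen's inequality for the convex function \<open>z \<mapsto> z\<^sup>-\<^sup>N\<close>, with weights \<open>\<tau> k\<close> and \<open>z = r k\<^sup>-\<^sup>2\<close>, proved by
  summing the tangent line inequality at the weighted mean.\<close>

lemma power_mean_inverse_squares:
  fixes \<tau> r :: "'a \<Rightarrow> real"
  assumes fin: "finite I" and ne: "I \<noteq> {}" and \<tau>: "\<And>k. k \<in> I \<Longrightarrow> 0 < \<tau> k" and r: "\<And>k. k \<in> I \<Longrightarrow> 0 < r k"
  shows "(1 / (\<Sum>k\<in>I. \<tau> k / (r k)\<^sup>2)) ^ N \<le> (\<Sum>k\<in>I. \<tau> k * r k ^ (2 * N)) / sum \<tau> I ^ Suc N"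
proof -
  define S where "S = sum \<tau> I"
  define \<mu> where "\<mu> = (\<Sum>k\<in>I. \<tau> k / (r k)\<^sup>2)"
  have S: "S > 0" unfolding S_def using fin ne \<tau> by (rule sum_pos)
  have "0 < \<tau> k / (r k)\<^sup>2" if "k \<in> I" for k
    using \<tau>[OF that] r[OF that] by simp
  then have \<mu>: "\<mu> > 0" unfolding \<mu>_def using fin ne by (intro sum_pos) auto
  define c where "c = \<mu> / S"
  have c: "c > 0" using S \<mu> by (simp add: c_def)
  have tangent: "1 + real N * (1 - 1 / ((r k)\<^sup>2 * c)) \<le> ((r k)\<^sup>2 * c) ^ N" if "k \<in> I" for k
  proof -
    define z where "z = (r k)\<^sup>2 * c"
    have z: "z > 0" using r[OF that] c by (simp add: z_def)
    have "(z - 1)\<^sup>2 \<ge> 0" by simp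
    then have "1 - 1 / z \<le> z - 1"
      using z by (simp add: field_simps power2_eq_square)
    then have "1 + real N * (1 - 1 / z) \<le> 1 + real N * (z - 1)" by (simp add: mult_left_mono)
    also have "\<dots> \<le> (1 + (z - 1)) ^ N" using z by (intro Bernoulli_inequality) simp
    finally show ?thesis by (simp add: z_def)
  qed
  have "S = S + real N * (S - \<mu> / c)" using S \<mu> by (simp add: c_def)
  also have "\<dots> = (\<Sum>k\<in>I. \<tau> k * (1 + real N * (1 - 1 / ((r k)\<^sup>2 * c))))"
    unfolding S_def \<mu>_def
    by (simp add: sum.distrib sum_subtractf sum_distrib_left sum_divide_distrib algebra_simps)
  also have "\<dots> \<le> (\<Sum>k\<in>I. \<tau> k * ((r k)\<^sup>2 * c) ^ N)"
    using tangent \<tau> by (intro sum_mono mult_left_mono) (auto simp: less_imp_le)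
  also have "\<dots> = (\<Sum>k\<in>I. \<tau> k * r k ^ (2 * N)) * c ^ N"
    by (simp add: power_mult_distrib power_mult sum_distrib_right mult.assoc)
  finally have "S \<le> (\<Sum>k\<in>I. \<tau> k * r k ^ (2 * N)) * c ^ N" .
  then have "S * S ^ N / \<mu> ^ N \<le> (\<Sum>k\<in>I. \<tau> k * r k ^ (2 * N))"
    using S \<mu> by (simp add: c_def power_divide field_simps)
  then have "1 / \<mu> ^ N \<le> (\<Sum>k\<in>I. \<tau> k * r k ^ (2 * N)) / S ^ Suc N"
    using S \<mu> by (simp add: field_simps)
  then show ?thesis by (simp add: \<mu>_def S_def power_one_over)
qed

text \<open>The deterministic core.  If all steps are good, \<open>gram_form_ge_sum\<close> and the power mean inequality
  give the second sum.  Otherwise one bad index is charged: the last step if it is bad, and any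
  bad earlier step \<open>k\<close> if the last step is good, because then the last but one step, which has the same
  length \<open>\<tau> k = h\<close>, can be used.\<close>

lemma gram_inverse_power_le:
  fixes F A :: "nat \<Rightarrow> real ^ 'd ^ 'd"
  assumes \<kappa>: "\<kappa> > 0" and n: "n > 0"
    and \<tau>: "\<And>i. i < n \<Longrightarrow> 0 < \<tau> i"
    and \<tau>_eq: "\<And>i. Suc i < n \<Longrightarrow> \<tau> i = h"
    and A: "\<And>i v. i < n \<Longrightarrow> \<kappa> * (norm v)\<^sup>2 \<le> v \<bullet> (A i *v v)"
    and F: "\<And>i. i < n \<Longrightarrow> good i \<Longrightarrow> norm (F i - mat 1) \<le> 1 / 2"
  shows "invertible (gram F A \<tau> n)"
    and "spectral_norm (matrix_inv (gram F A \<tau> n)) ^ N \<le>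
      (\<Sum>k<n. if good k then 0 else (4 / (\<kappa> * \<tau> k)) ^ N) +
      (1 / \<kappa>) ^ N * (\<Sum>k<n. \<tau> k * norm (inverse_chain F good (Suc k) n) ^ (2 * N)) / (\<Sum>k<n. \<tau> k) ^ Suc N"
proof -
  let ?G = "gram F A \<tau> n"
  let ?bad = "\<lambda>k. if good k then 0 else (4 / (\<kappa> * \<tau> k)) ^ N"
  let ?chain = "(1 / \<kappa>) ^ N * (\<Sum>k<n. \<tau> k * norm (inverse_chain F good (Suc k) n) ^ (2 * N)) / (\<Sum>k<n. \<tau> k) ^ Suc N"
  have bad0: "0 \<le> ?bad k" if "k < n" for k using \<kappa> \<tau>[OF that] by simp
  have S: "0 < (\<Sum>k<n. \<tau> k)" using n \<tau> by (intro sum_pos) auto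
  have chain0: "0 \<le> ?chain"
    using \<kappa> \<tau> S by (intro divide_nonneg_nonneg mult_nonneg_nonneg sum_nonneg) (auto simp: less_imp_le)
  have norm0: "0 \<le> spectral_norm (matrix_inv ?G)"
    unfolding spectral_norm_def by (rule onorm_pos_le) (rule matrix_vector_mul_bounded_linear)
  obtain l where l: "n = Suc l" using n by (cases n) auto
  note ge_last = gram_form_ge_last[where n = n and F = F and A = A and \<tau> = \<tau> and \<kappa> = \<kappa>, OF \<kappa> \<tau> A]
  have last: "\<kappa> * \<tau> l * (norm v)\<^sup>2 \<le> v \<bullet> (?G *v v)" for v
    using ge_last[of l v] l by simp
  have pos: "0 < \<kappa> * \<tau> l" using \<kappa> \<tau> l by simp
  show "invertible ?G" by (rule spectral_norm_inverse_le(1)[OF pos last])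
  have single: "spectral_norm (matrix_inv ?G) ^ N \<le> (\<Sum>k<n. ?bad k) + ?chain"
    if k: "k < n" "\<not> good k" and le: "spectral_norm (matrix_inv ?G) \<le> 4 / (\<kappa> * \<tau> k)" for k
  proof -
    have "spectral_norm (matrix_inv ?G) ^ N \<le> ?bad k"
      using k norm0 le by (auto intro!: power_mono)
    also have "\<dots> \<le> (\<Sum>k<n. ?bad k)" by (rule member_le_sum) (use k bad0 in auto)
    finally show ?thesis using chain0 by linarith
  qed
  show "spectral_norm (matrix_inv ?G) ^ N \<le> (\<Sum>k<n. ?bad k) + ?chain"
  proof (cases "\<forall>k<n. good k")
    case True
    let ?r = "\<lambda>k. norm (inverse_chain F good (Suc k) n)"
    have inv: "good i \<and> invertible (F i)" if "i < n" for i
      using True that invertible_mat1_plus[OF F, of i] by simp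
    define u0 where "u0 = (axis undefined 1 :: real ^ 'd)"
    have r: "0 < ?r k" if k: "k < n" for k
    proof -
      obtain u where u: "u0 = inverse_chain F good (Suc k) n *v u"
        using gram_form_ge_sum[where n = n and F = F and A = A and \<tau> = \<tau> and \<kappa> = \<kappa> and v = u0, OF \<kappa> \<tau> A inv order_refl] k by blast
      have "u0 \<noteq> 0" by (simp add: u0_def)
      then have "inverse_chain F good (Suc k) n \<noteq> 0" using u by auto
      then show ?thesis by simp
    qed
    define \<mu> where "\<mu> = (\<Sum>k<n. \<tau> k / (?r k)\<^sup>2)"
    have "0 < \<tau> k / (?r k)\<^sup>2" if "k < n" for k
      using \<tau>[OF that] r[OF that] by simp
    then have \<mu>: "\<mu> > 0" unfolding \<mu>_def using n by (intro sum_pos) auto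
    have "\<kappa> * \<mu> * (norm v)\<^sup>2 \<le> v \<bullet> (?G *v v)" for v
    proof -
      obtain u where u: "\<And>k. k < n \<Longrightarrow> v = inverse_chain F good (Suc k) n *v u k"
        and le: "\<kappa> * (\<Sum>k<n. \<tau> k * (norm (u k))\<^sup>2) \<le> v \<bullet> (?G *v v)"
        using gram_form_ge_sum[where n = n and F = F and A = A and \<tau> = \<tau> and \<kappa> = \<kappa> and v = v, OF \<kappa> \<tau> A inv order_refl] by auto
      have "\<tau> k / (?r k)\<^sup>2 * (norm v)\<^sup>2 \<le> \<tau> k * (norm (u k))\<^sup>2" if k: "k < n" for k
      proof -
        have "norm v \<le> ?r k * norm (u k)"
          using norm_matrix_vector_le[of "inverse_chain F good (Suc k) n" "u k"] u[OF k] by simp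
        then have "(norm v)\<^sup>2 \<le> (?r k * norm (u k))\<^sup>2" by (rule power_mono) simp
        then have "(norm v)\<^sup>2 / (?r k)\<^sup>2 \<le> (norm (u k))\<^sup>2"
          using r[OF k] by (simp add: field_simps power_mult_distrib)
        then show ?thesis using \<tau>[OF k] mult_left_mono[of _ _ "\<tau> k"] by fastforce
      qed
      then have "\<mu> * (norm v)\<^sup>2 \<le> (\<Sum>k<n. \<tau> k * (norm (u k))\<^sup>2)"
        unfolding \<mu>_def sum_distrib_right by (intro sum_mono) simp
      then have "\<kappa> * (\<mu> * (norm v)\<^sup>2) \<le> \<kappa> * (\<Sum>k<n. \<tau> k * (norm (u k))\<^sup>2)"
        using \<kappa> by (intro mult_left_mono) auto
      with le show ?thesis by (simp add: mult.assoc)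
    qed
    then have "spectral_norm (matrix_inv ?G) \<le> 1 / (\<kappa> * \<mu>)"
      using \<kappa> \<mu> by (intro spectral_norm_inverse_le(2)) auto
    then have "spectral_norm (matrix_inv ?G) ^ N \<le> (1 / (\<kappa> * \<mu>)) ^ N"
      using norm0 by (intro power_mono) auto
    also have "\<dots> = (1 / \<kappa>) ^ N * (1 / \<mu>) ^ N"
      by (simp add: power_mult_distrib power_divide)
    also have "\<dots> \<le> (1 / \<kappa>) ^ N * ((\<Sum>k<n. \<tau> k * ?r k ^ (2 * N)) / (\<Sum>k<n. \<tau> k) ^ Suc N)"
    proof (rule mult_left_mono)
      show "(1 / \<mu>) ^ N \<le> (\<Sum>k<n. \<tau> k * ?r k ^ (2 * N)) / (\<Sum>k<n. \<tau> k) ^ Suc N"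
        unfolding \<mu>_def using n \<tau> r by (intro power_mean_inverse_squares) auto
    qed (use \<kappa> in simp)
    also have "\<dots> = ?chain" by simp
    finally have "spectral_norm (matrix_inv ?G) ^ N \<le> ?chain" .
    moreover have "0 \<le> (\<Sum>k<n. ?bad k)" using bad0 by (intro sum_nonneg) auto
    ultimately show ?thesis by linarith
  next
    case bad: False
    show ?thesis
    proof (cases "good l")
      case False
      have "spectral_norm (matrix_inv ?G) \<le> 1 / (\<kappa> * \<tau> l)"
        by (rule spectral_norm_inverse_le(2)[OF pos last])
      also have "\<dots> \<le> 4 / (\<kappa> * \<tau> l)" using pos by (intro divide_right_mono) auto
      finally show ?thesis using False l by (intro single[of l]) auto
    next
      case True
      then obtain k where k: "k < l" "\<not> good k" using bad l by (auto simp: less_Suc_eq)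
      then obtain i where i: "l = Suc i" by (cases l) auto
      have pos': "0 < \<kappa> * \<tau> i / 4" using \<kappa> \<tau>[of i] i l by simp
      note pen = gram_form_ge_penultimate[where n = n and F = F and A = A and \<tau> = \<tau> and \<kappa> = \<kappa>, OF \<kappa> \<tau> A]
      have "\<kappa> * \<tau> i / 4 * (norm v)\<^sup>2 \<le> v \<bullet> (?G *v v)" for v
        using pen[of i v] F[of l] True i l by simp
      then have "spectral_norm (matrix_inv ?G) \<le> 1 / (\<kappa> * \<tau> i / 4)"
        by (intro spectral_norm_inverse_le(2) pos')
      then have "spectral_norm (matrix_inv ?G) \<le> 4 / (\<kappa> * \<tau> k)"
        using \<tau>_eq[of i] \<tau>_eq[of k] i k l by simp
      then show ?thesis using k l by (intro single[of k]) auto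
    qed
  qed
qed

section \<open>The Jacobians of one Euler step\<close>

lemma C_on_imp_continuous_on: "C_on k S f \<Longrightarrow> continuous_on S f"
  by (cases k) (auto intro: has_derivative_continuous_on)

lemma C_on_partial_x:
  fixes f :: "real \<Rightarrow> real ^ 'd \<Rightarrow> 'b::real_normed_vector"
  assumes f: "C_on (Suc k) ({0..} \<times> UNIV) (\<lambda>(t, x). f t x)"
  shows has_vector_derivative_partial_x:
      "0 \<le> t \<Longrightarrow> ((\<lambda>r. f t (x + r *\<^sub>R axis i 1)) has_vector_derivative partial_x i f t x) (at 0)"
    and continuous_on_partial_x: "0 \<le> t \<Longrightarrow> continuous_on UNIV (partial_x i f t)"
proof -
  obtain f' where
    f': "\<And>z. z \<in> {0..} \<times> UNIV \<Longrightarrow> ((\<lambda>(t, x). f t x) has_derivative f' z) (at z within {0..} \<times> UNIV)"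
    and cont: "\<And>e. e \<in> Basis \<Longrightarrow> C_on k ({0..} \<times> UNIV) (\<lambda>z. f' z e)"
    using f by auto
  have deriv: "((\<lambda>r. f t (x + r *\<^sub>R axis i 1)) has_vector_derivative f' (t, x) (0, axis i 1)) (at 0)"
    if t: "0 \<le> t" for t x
  proof -
    have "((\<lambda>r. (t, x + r *\<^sub>R axis i 1)) has_vector_derivative (0, axis i 1)) (at 0)"
      by (auto intro!: derivative_eq_intros)
    moreover have "((\<lambda>(t, x). f t x) has_derivative f' (t, x + 0 *\<^sub>R axis i 1))
        (at (t, x + 0 *\<^sub>R axis i 1) within range (\<lambda>r. (t, x + r *\<^sub>R axis i 1)))"
      using f'[of "(t, x)"] t by (auto intro: has_derivative_subset)
    ultimately have "(((\<lambda>(t, x). f t x) \<circ> (\<lambda>r. (t, x + r *\<^sub>R axis i 1)))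
        has_vector_derivative f' (t, x + 0 *\<^sub>R axis i 1) (0, axis i 1)) (at 0)"
      by (rule vector_derivative_diff_chain_within)
    then show ?thesis by (simp add: o_def)
  qed
  then have eq: "partial_x i f t x = f' (t, x) (0, axis i 1)" if "0 \<le> t" for t x
    unfolding partial_x_def using that by (intro vector_derivative_at) auto
  show "((\<lambda>r. f t (x + r *\<^sub>R axis i 1)) has_vector_derivative partial_x i f t x) (at 0)" if "0 \<le> t"
    using deriv[OF that] eq[OF that] by simp
  show "continuous_on UNIV (partial_x i f t)" if t: "0 \<le> t"
  proof -
    have "(0, axis i 1) \<in> (Basis :: (real \<times> (real ^ 'd)) set)"
      by (simp add: Basis_prod_def axis_in_Basis_iff)
    then have "continuous_on ({0..} \<times> UNIV) (\<lambda>z. f' z (0, axis i 1))"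
      using cont by (intro C_on_imp_continuous_on)
    then have "continuous_on UNIV (\<lambda>x. f' (t, x) (0, axis i 1))"
      by (rule continuous_on_compose2) (use t in \<open>auto intro!: continuous_intros\<close>)
    moreover have "partial_x i f t = (\<lambda>x. f' (t, x) (0, axis i 1))" using eq[OF t] by auto
    ultimately show ?thesis by simp
  qed
qed

lemma C_on_continuous_space:
  fixes f :: "real \<Rightarrow> real ^ 'd \<Rightarrow> 'b::real_normed_vector"
  assumes f: "C_on k ({0..} \<times> UNIV) (\<lambda>(t, x). f t x)" and t: "0 \<le> t"
  shows "continuous_on UNIV (f t)"
proof -
  have "continuous_on UNIV (\<lambda>x. case (t, x) of (t, x) \<Rightarrow> f t x)"
    by (rule continuous_on_compose2[OF C_on_imp_continuous_on[OF f]]) (use t in \<open>auto intro!: continuous_intros\<close>)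
  then show ?thesis by simp
qed

text \<open>The first derivatives of the coefficients are controlled through the Lipschitz conditions; the
  growth conditions concern the higher ones.\<close>

lemma abs_vector_derivative_le_Lipschitz:
  fixes g :: "real \<Rightarrow> real"
  assumes g: "(g has_vector_derivative v) (at 0)" and L: "\<And>r. \<bar>g r - g 0\<bar> \<le> L * \<bar>r\<bar>"
  shows "\<bar>v\<bar> \<le> L"
proof -
  have "((\<lambda>r. (g r - g 0) / (r - 0)) \<longlongrightarrow> v) (at 0)"
    using g by (simp add: has_real_derivative_iff_has_vector_derivative[symmetric] has_field_derivative_iff)
  then have "((\<lambda>r. \<bar>(g r - g 0) / (r - 0)\<bar>) \<longlongrightarrow> \<bar>v\<bar>) (at 0)" by (rule tendsto_rabs)
  moreover have "\<forall>\<^sub>F r in at 0. \<bar>(g r - g 0) / (r - 0)\<bar> \<le> L"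
    unfolding eventually_at_filter using L by (auto simp: abs_divide divide_le_eq)
  ultimately show ?thesis by (rule tendsto_upperbound) simp
qed

definition drift_jacobian :: "(real \<Rightarrow> real ^ 'd \<Rightarrow> real ^ 'd) \<Rightarrow> real \<Rightarrow> real ^ 'd \<Rightarrow> real ^ 'd ^ 'd" where
  "drift_jacobian b s x = (\<chi> i j. partial_x i b s x $ j)"

definition diffusion_jacobian ::
    "(real \<Rightarrow> real ^ 'd \<Rightarrow> real ^ 'm ^ 'd) \<Rightarrow> 'm \<Rightarrow> real \<Rightarrow> real ^ 'd \<Rightarrow> real ^ 'd ^ 'd" where
  "diffusion_jacobian \<sigma> l s x = (\<chi> i j. partial_x i \<sigma> s x $ j $ l)"

definition step_error ::
    "(real \<Rightarrow> real ^ 'd \<Rightarrow> real ^ 'd) \<Rightarrow> (real \<Rightarrow> real ^ 'd \<Rightarrow> real ^ 'm ^ 'd) \<Rightarrow> real \<Rightarrow> real ^ 'd \<Rightarrow>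
     real \<Rightarrow> real ^ 'm \<Rightarrow> real ^ 'd ^ 'd" where
  "step_error b \<sigma> s x \<tau> \<xi> =
     \<tau> *\<^sub>R drift_jacobian b s x + (\<Sum>l\<in>UNIV. \<xi> $ l *\<^sub>R diffusion_jacobian \<sigma> l s x)"

lemma euler_F_eq:
  "euler_F b \<sigma> h w Y n t =
     mat 1 + step_error b \<sigma> (real n * h) (Y (real n * h)) (t - real n * h) (w t - w (real n * h))"
  by (simp add: euler_F_def Let_def step_error_def drift_jacobian_def diffusion_jacobian_def
      vec_eq_iff mat_def mult_ac)

lemma norm_drift_jacobian_le:
  fixes b :: "real \<Rightarrow> real ^ 'd \<Rightarrow> real ^ 'd"
  assumes b: "drift_condition L C q b" and s: "0 \<le> s"
  shows "norm (drift_jacobian b s x) \<le> real CARD('d) * real CARD('d) * L"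
proof (rule norm_matrix_le_entries)
  fix i j :: 'd
  have C: "C_on (Suc 2) ({0..} \<times> UNIV) (\<lambda>(t, x). b t x)"
    and lip: "\<And>x1 x2. norm (b s x1 - b s x2) \<le> L * norm (x1 - x2)"
    using b s unfolding drift_condition_def eval_nat_numeral by auto
  have "\<bar>partial_x i b s x $ j\<bar> \<le> L"
  proof (rule abs_vector_derivative_le_Lipschitz)
    show "((\<lambda>r. b s (x + r *\<^sub>R axis i 1) $ j) has_vector_derivative partial_x i b s x $ j) (at 0)"
      by (rule bounded_linear.has_vector_derivative[OF bounded_linear_vec_nth has_vector_derivative_partial_x[OF C s]])
    fix r :: real
    have "\<bar>b s (x + r *\<^sub>R axis i 1) $ j - b s x $ j\<bar> \<le> norm (b s (x + r *\<^sub>R axis i 1) - b s x)"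
      using component_le_norm_cart[of "b s (x + r *\<^sub>R axis i 1) - b s x" j] by simp
    also have "\<dots> \<le> L * norm (r *\<^sub>R axis i (1::real))"
      using lip[of "x + r *\<^sub>R axis i 1" x] by simp
    finally show "\<bar>b s (x + r *\<^sub>R axis i 1) $ j - b s (x + 0 *\<^sub>R axis i 1) $ j\<bar> \<le> L * \<bar>r\<bar>"
      by simp
  qed
  then show "\<bar>drift_jacobian b s x $ i $ j\<bar> \<le> L" by (simp add: drift_jacobian_def)
qed

lemma norm_diffusion_jacobian_le:
  fixes \<sigma> :: "real \<Rightarrow> real ^ 'd \<Rightarrow> real ^ 'm ^ 'd"
  assumes \<sigma>: "diffusion_condition L C q \<kappa> \<sigma>" and s: "0 \<le> s"
  shows "norm (diffusion_jacobian \<sigma> l s x) \<le> real CARD('d) * real CARD('d) * L"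
proof (rule norm_matrix_le_entries)
  fix i j :: 'd
  have C: "C_on (Suc 2) ({0..} \<times> UNIV) (\<lambda>(t, x). \<sigma> t x)"
    and lip: "\<And>x1 x2. spectral_norm (\<sigma> s x1 - \<sigma> s x2) \<le> L * norm (x1 - x2)"
    using \<sigma> s unfolding diffusion_condition_def eval_nat_numeral by auto
  have "\<bar>partial_x i \<sigma> s x $ j $ l\<bar> \<le> L"
  proof (rule abs_vector_derivative_le_Lipschitz)
    show "((\<lambda>r. \<sigma> s (x + r *\<^sub>R axis i 1) $ j $ l) has_vector_derivative partial_x i \<sigma> s x $ j $ l) (at 0)"
      by (rule bounded_linear.has_vector_derivative[OF bounded_linear_vec_nth
            bounded_linear.has_vector_derivative[OF bounded_linear_vec_nth has_vector_derivative_partial_x[OF C s]]])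
    fix r :: real
    have "\<bar>\<sigma> s (x + r *\<^sub>R axis i 1) $ j $ l - \<sigma> s x $ j $ l\<bar> \<le> spectral_norm (\<sigma> s (x + r *\<^sub>R axis i 1) - \<sigma> s x)"
      using matrix_component_le_onorm[of "\<sigma> s (x + r *\<^sub>R axis i 1) - \<sigma> s x" j l]
      by (simp add: spectral_norm_def)
    also have "\<dots> \<le> L * norm (r *\<^sub>R axis i (1::real))"
      using lip[of "x + r *\<^sub>R axis i 1" x] by simp
    finally show "\<bar>\<sigma> s (x + r *\<^sub>R axis i 1) $ j $ l - \<sigma> s (x + 0 *\<^sub>R axis i 1) $ j $ l\<bar> \<le> L * \<bar>r\<bar>"
      by simp
  qed
  then show "\<bar>diffusion_jacobian \<sigma> l s x $ i $ j\<bar> \<le> L" by (simp add: diffusion_jacobian_def)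
qed

lemma diffusion_matrix_elliptic:
  assumes \<sigma>: "diffusion_condition L C q \<kappa> \<sigma>" and s: "0 \<le> s"
  shows "\<kappa> * (norm v)\<^sup>2 \<le> v \<bullet> (diffusion_matrix \<sigma> s x *v v)"
proof -
  have "0 \<le> v \<bullet> ((diffusion_matrix \<sigma> s x - \<kappa> *\<^sub>R mat 1) *v v)"
    using \<sigma> s unfolding diffusion_condition_def psd_def by blast
  then show ?thesis
    by (simp add: matrix_vector_mult_diff_rdistrib inner_diff_right scaleR_matrix_vector_assoc[symmetric]
        power2_norm_eq_inner)
qed

section \<open>The Malliavin matrix on the grid\<close>

text \<open>The grid points in \<open>[m h, t)\<close>, followed by \<open>t\<close> itself.\<close>

definition grid :: "real \<Rightarrow> nat \<Rightarrow> real \<Rightarrow> nat \<Rightarrow> real" where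
  "grid h m t i = min (real (m + i) * h) t"

definition num_steps :: "real \<Rightarrow> nat \<Rightarrow> real \<Rightarrow> nat" where
  "num_steps h m t = nat \<lceil>t / h\<rceil> - m"

lemma grid_num_steps:
  assumes h: "0 < h" and t: "real m * h < t"
  shows "num_steps h m t > 0" and "nat \<lceil>t / h\<rceil> = m + num_steps h m t"
    and "i < num_steps h m t \<Longrightarrow> real (m + i) * h < t"
    and "grid h m t (num_steps h m t) = t"
proof -
  have "real m < t / h" using h t by (simp add: field_simps)
  then have c: "int m < \<lceil>t / h\<rceil>" by linarith
  then show 1: "num_steps h m t > 0" "nat \<lceil>t / h\<rceil> = m + num_steps h m t"
    by (auto simp: num_steps_def)
  have c': "\<lceil>t / h\<rceil> = int (m + num_steps h m t)" using 1(2) c by linarith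
  then have "t / h \<le> real (m + num_steps h m t)" by linarith
  then show "grid h m t (num_steps h m t) = t"
    using h by (simp add: grid_def field_simps)
  assume "i < num_steps h m t"
  then have "real (m + i) < t / h" using c' by linarith
  then show "real (m + i) * h < t" using h by (simp add: field_simps)
qed

lemma grid_below:
  assumes h: "0 < h" and t: "real m * h < t" and i: "i < num_steps h m t"
  shows "grid h m t i = real (m + i) * h" and "grid h m t i < grid h m t (Suc i)"
    and "grid h m t (Suc i) - grid h m t i \<le> h"
    and "Suc i < num_steps h m t \<Longrightarrow> grid h m t (Suc i) - grid h m t i = h"
proof -
  have lt: "real (m + i) * h < t" by (rule grid_num_steps(3)[OF h t i])
  then show eq: "grid h m t i = real (m + i) * h" by (simp add: grid_def)
  show "grid h m t i < grid h m t (Suc i)"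
    unfolding eq using lt h by (simp add: grid_def algebra_simps)
  show "grid h m t (Suc i) - grid h m t i \<le> h"
    unfolding eq using h by (simp add: grid_def algebra_simps min_le_iff_disj)
  assume "Suc i < num_steps h m t"
  then have "real (m + Suc i) * h < t" by (rule grid_num_steps(3)[OF h t])
  then have "grid h m t (Suc i) = real (m + Suc i) * h" by (simp add: grid_def)
  then show "grid h m t (Suc i) - grid h m t i = h"
    unfolding eq by (simp add: algebra_simps)
qed

lemma mono_grid: "0 < h \<Longrightarrow> mono (grid h m t)"
  unfolding grid_def by (intro monoI min.mono mult_right_mono) auto

lemma grid_0: "0 < h \<Longrightarrow> real m * h < t \<Longrightarrow> grid h m t 0 = real m * h"
  by (simp add: grid_def)

lemma grid_nonneg: "0 < h \<Longrightarrow> real m * h < t \<Longrightarrow> 0 \<le> grid h m t i"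
  unfolding grid_def by (smt (verit) mult_nonneg_nonneg of_nat_0_le_iff)

lemma grid_ge: "0 < h \<Longrightarrow> real m * h < t \<Longrightarrow> real m * h \<le> grid h m t i"
  unfolding grid_def by (simp add: algebra_simps)

definition grid_gram ::
    "(real \<Rightarrow> real ^ 'd \<Rightarrow> real ^ 'd) \<Rightarrow> (real \<Rightarrow> real ^ 'd \<Rightarrow> real ^ 'm ^ 'd) \<Rightarrow> (nat \<Rightarrow> real) \<Rightarrow>
     (nat \<Rightarrow> real ^ 'd) \<Rightarrow> (nat \<Rightarrow> real ^ 'm) \<Rightarrow> nat \<Rightarrow> real ^ 'd ^ 'd" where
  "grid_gram b \<sigma> s x e =
     gram (\<lambda>i. mat 1 + step_error b \<sigma> (s i) (x i) (s (Suc i) - s i) (e i))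
       (\<lambda>i. diffusion_matrix \<sigma> (s i) (x i)) (\<lambda>i. s (Suc i) - s i)"

text \<open>Splitting the integral at the last grid point: there the integrand is conjugated by \<open>F\<close>, and after it
  the derivative is the constant \<open>\<sigma>\<^sup>T\<close>.  The equality holds for arbitrary paths, so the Malliavin matrix is
  a measurable function of finitely many values of \<open>W\<close> and \<open>Y\<close>.\<close>

lemma malliavin_matrix_eq_gram:
  fixes b :: "real \<Rightarrow> real ^ 'd \<Rightarrow> real ^ 'd" and \<sigma> :: "real \<Rightarrow> real ^ 'd \<Rightarrow> real ^ 'm ^ 'd"
  assumes h: "0 < h" and t: "real m * h < t"
  shows "malliavin_matrix b \<sigma> h m w Y t =
    grid_gram b \<sigma> (grid h m t) (\<lambda>i. Y (grid h m t i))
      (\<lambda>i. w (grid h m t (Suc i)) - w (grid h m t i)) (num_steps h m t)"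
proof -
  define s where "s = grid h m t"
  define g where "g = grid_gram b \<sigma> s (\<lambda>i. Y (s i)) (\<lambda>i. w (s (Suc i)) - w (s i))"
  let ?D = "\<lambda>i r. malliavin_step b \<sigma> h m w Y r (m + i) (s i)"
  have "((\<lambda>r. transpose (?D i r) ** ?D i r) has_integral g i) {s 0..s i}" if "i \<le> num_steps h m t" for i
    using that
  proof (induction i)
    case 0
    show ?case by (simp add: g_def grid_gram_def has_integral_refl)
  next
    case (Suc i)
    then have i: "i < num_steps h m t" by simp
    have si: "s i = real (m + i) * h" and lt: "s i < s (Suc i)"
      using grid_below[OF h t i] by (simp_all add: s_def)
    have s0: "s 0 \<le> s i" using mono_grid[OF h] by (simp add: s_def monoD)
    define F where "F = euler_F b \<sigma> h w Y (m + i) (s (Suc i))"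
    define A where "A = diffusion_matrix \<sigma> (s i) (Y (s i))"
    have g_Suc: "g (Suc i) = transpose F ** g i ** F + (s (Suc i) - s i) *\<^sub>R A"
      by (simp add: g_def grid_gram_def F_def A_def euler_F_eq si[symmetric] del: of_nat_add)
    have lin: "bounded_linear (\<lambda>X :: real ^ 'd ^ 'd. transpose F ** X ** F)"
      by (intro bounded_linear_compose[OF bounded_bilinear.bounded_linear_left[OF bounded_bilinear_matrix_mult]
            bounded_bilinear.bounded_linear_right[OF bounded_bilinear_matrix_mult]])
    have "((\<lambda>r. transpose F ** (transpose (?D i r) ** ?D i r) ** F) has_integral transpose F ** g i ** F) {s 0..s i}"
      using has_integral_linear[OF Suc.IH lin] i by (simp add: o_def)
    moreover have "transpose F ** (transpose (?D i r) ** ?D i r) ** F = transpose (?D (Suc i) r) ** ?D (Suc i) r"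
      if "r \<in> {s 0..s i}" for r
    proof -
      have "?D (Suc i) r = ?D i r ** F"
        using that lt by (simp add: F_def si[symmetric] del: of_nat_add)
      then show ?thesis by (simp add: matrix_transpose_mul matrix_mul_assoc)
    qed
    ultimately have I1: "((\<lambda>r. transpose (?D (Suc i) r) ** ?D (Suc i) r) has_integral transpose F ** g i ** F) {s 0..s i}"
      by (rule has_integral_eq[rotated])
    have I2: "((\<lambda>r. transpose (?D (Suc i) r) ** ?D (Suc i) r) has_integral (s (Suc i) - s i) *\<^sub>R A) {s i..s (Suc i)}"
    proof (rule has_integral_spike_finite)
      show "finite {s i}" by simp
      show "((\<lambda>_. A) has_integral (s (Suc i) - s i) *\<^sub>R A) {s i..s (Suc i)}"
        using has_integral_const_real[of A "s i" "s (Suc i)"] lt by simp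
      show "transpose (?D (Suc i) r) ** ?D (Suc i) r = A" if "r \<in> {s i..s (Suc i)} - {s i}" for r
        using that by (simp add: A_def diffusion_matrix_def si[symmetric] del: of_nat_add)
    qed
    show ?case
      unfolding g_Suc using s0 lt by (intro has_integral_combine[OF _ _ I1 I2]) auto
  qed
  from this[OF order_refl]
  have "((\<lambda>r. transpose (malliavin_euler b \<sigma> h m w Y r t) ** malliavin_euler b \<sigma> h m w Y r t)
      has_integral g (num_steps h m t)) {real m * h..t}"
    using grid_num_steps(2,4)[OF h t] grid_0[OF h t]
    by (simp add: s_def malliavin_euler_def)
  then show ?thesis
    unfolding malliavin_matrix_def g_def s_def by (rule integral_unique)
qed

primrec euler_state ::
    "(real \<Rightarrow> real ^ 'd \<Rightarrow> real ^ 'd) \<Rightarrow> (real \<Rightarrow> real ^ 'd \<Rightarrow> real ^ 'm ^ 'd) \<Rightarrow> real ^ 'd \<Rightarrow> (nat \<Rightarrow> real) \<Rightarrow>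
     (nat \<Rightarrow> real ^ 'm) \<Rightarrow> nat \<Rightarrow> real ^ 'd" where
  "euler_state b \<sigma> y s e 0 = y"
| "euler_state b \<sigma> y s e (Suc i) =
     (let x = euler_state b \<sigma> y s e i in x + (s (Suc i) - s i) *\<^sub>R b (s i) x + \<sigma> (s i) x *v e i)"

lemma euler_path_eq_state:
  assumes h: "0 < h" and t: "real m * h < t" and Y: "euler_path b \<sigma> h m y w Y"
    and i: "i \<le> num_steps h m t"
  shows "Y (grid h m t i) =
    euler_state b \<sigma> y (grid h m t) (\<lambda>i. w (grid h m t (Suc i)) - w (grid h m t i)) i"
  using i
proof (induction i)
  case 0
  then show ?case using euler_path_start[OF h Y] by (simp add: grid_0[OF h t])
next
  case (Suc i)
  then have i: "i < num_steps h m t" by simp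
  note gi = grid_below[OF h t i]
  have "grid h m t (Suc i) \<le> real (Suc (m + i)) * h" by (simp add: grid_def)
  from euler_path_step[OF h Y _ _ this] gi Suc i show ?case
    by (simp add: Let_def)
qed

section \<open>Measurability\<close>

lemma borel_measurable_vecI:
  fixes f :: "'w \<Rightarrow> ('b::euclidean_space) ^ 'n"
  assumes "\<And>i. (\<lambda>\<omega>. f \<omega> $ i) \<in> borel_measurable M"
  shows "f \<in> borel_measurable M"
proof (rule borel_measurable_euclidean_space[THEN iffD2], rule ballI)
  fix u :: "'b ^ 'n" assume "u \<in> Basis"
  then obtain i v where u: "u = axis i v" by (auto simp: Basis_vec_def)
  show "(\<lambda>\<omega>. f \<omega> \<bullet> u) \<in> borel_measurable M"
    unfolding u inner_axis by (intro borel_measurable_inner assms) simp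
qed

lemma borel_measurable_vec_nth:
  fixes f :: "'w \<Rightarrow> ('b::euclidean_space) ^ 'n"
  assumes "f \<in> borel_measurable M"
  shows "(\<lambda>\<omega>. f \<omega> $ i) \<in> borel_measurable M"
  by (rule borel_measurable_continuous_on[OF _ assms]) (intro continuous_intros)

lemma borel_measurable_matrix_mult:
  fixes f :: "'w \<Rightarrow> real ^ 'n ^ 'k" and g :: "'w \<Rightarrow> real ^ 'l ^ 'n"
  assumes "f \<in> borel_measurable M" "g \<in> borel_measurable M"
  shows "(\<lambda>\<omega>. f \<omega> ** g \<omega>) \<in> borel_measurable M"
  using assms by (rule borel_measurable_continuous_Pair)
    (intro bounded_bilinear.continuous_on[OF bounded_bilinear_matrix_mult] continuous_intros)

lemma borel_measurable_matrix_vector_mult: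
  fixes f :: "'w \<Rightarrow> real ^ 'n ^ 'k" and g :: "'w \<Rightarrow> real ^ 'n"
  assumes "f \<in> borel_measurable M" "g \<in> borel_measurable M"
  shows "(\<lambda>\<omega>. f \<omega> *v g \<omega>) \<in> borel_measurable M"
  using assms by (rule borel_measurable_continuous_Pair)
    (intro bounded_bilinear.continuous_on[OF bounded_bilinear_matrix_vector] continuous_intros)

lemma borel_measurable_transpose:
  fixes f :: "'w \<Rightarrow> real ^ 'n ^ 'k"
  assumes "f \<in> borel_measurable M"
  shows "(\<lambda>\<omega>. transpose (f \<omega>)) \<in> borel_measurable M"
  unfolding transpose_def
  by (intro borel_measurable_vecI) (simp add: borel_measurable_vec_nth assms)

lemma borel_measurable_det:
  fixes f :: "'w \<Rightarrow> real ^ 'n ^ 'n"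
  assumes "f \<in> borel_measurable M"
  shows "(\<lambda>\<omega>. det (f \<omega>)) \<in> borel_measurable M"
  unfolding det_def
  by (intro borel_measurable_sum borel_measurable_times borel_measurable_prod borel_measurable_const
      borel_measurable_vec_nth assms)

text \<open>Cramer's rule on the invertible matrices; on the others \<open>matrix_inv\<close> is a fixed choice, because the
  predicate from which it chooses is then the same for all of them.\<close>

lemma borel_measurable_matrix_inv:
  fixes f :: "'w \<Rightarrow> real ^ 'n ^ 'n"
  assumes f: "f \<in> borel_measurable M"
  shows "(\<lambda>\<omega>. matrix_inv (f \<omega>)) \<in> borel_measurable M"
proof -
  define minor where
    "minor = (\<lambda>i j (A :: real ^ 'n ^ 'n). \<chi> p q. if q = i then axis j 1 $ p else A $ p $ q)"
  define no_inverse :: "real ^ 'n ^ 'n" where "no_inverse = (SOME A. False)"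
  have eq: "matrix_inv A = (if det A = 0 then no_inverse else (\<chi> i j. det (minor i j A) / det A))"
    for A :: "real ^ 'n ^ 'n"
  proof (cases "det A = 0")
    case True
    then have "\<not> invertible A" by (simp add: invertible_det_nz)
    then have "(\<lambda>B. A ** B = mat 1 \<and> B ** A = mat 1) = (\<lambda>B. False)"
      unfolding invertible_def by blast
    with True show ?thesis by (simp add: matrix_inv_def no_inverse_def)
  next
    case False
    then have inv: "invertible A" by (simp add: invertible_det_nz)
    have "matrix_inv A $ i $ j = det (minor i j A) / det A" for i j
    proof -
      have "A *v (matrix_inv A *v axis j 1) = axis j 1"
        by (simp add: matrix_vector_mul_assoc matrix_inv_mult[OF inv])
      then have "matrix_inv A *v axis j 1 =
          (\<chi> k. det (\<chi> p q. if q = k then axis j 1 $ p else A $ p $ q) / det A)"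
        by (subst (asm) cramer[OF False])
      then have "(matrix_inv A *v axis j 1) $ i = det (minor i j A) / det A"
        by (simp add: minor_def)
      then show ?thesis by (simp add: matrix_vector_mul_component inner_axis)
    qed
    with False show ?thesis by (simp add: vec_eq_iff)
  qed
  have "(\<lambda>\<omega>. minor i j (f \<omega>)) \<in> borel_measurable M" for i j
  proof (intro borel_measurable_vecI)
    show "(\<lambda>\<omega>. minor i j (f \<omega>) $ p $ r) \<in> borel_measurable M" for p r
      unfolding minor_def using f by (cases "r = i") (simp_all add: borel_measurable_vec_nth)
  qed
  then have "(\<lambda>\<omega>. \<chi> i j. det (minor i j (f \<omega>)) / det (f \<omega>)) \<in> borel_measurable M"
    by (intro borel_measurable_vecI) (simp add: borel_measurable_det f borel_measurable_divide)
  moreover have "{\<omega> \<in> space M. det (f \<omega>) = 0} \<in> sets M"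
    using borel_measurable_det[OF f] by measurable
  ultimately show ?thesis
    unfolding eq by (intro measurable_If borel_measurable_const) auto
qed

lemma borel_measurable_spectral_norm:
  fixes f :: "'w \<Rightarrow> real ^ 'n ^ 'k"
  assumes "f \<in> borel_measurable M"
  shows "(\<lambda>\<omega>. spectral_norm (f \<omega>)) \<in> borel_measurable M"
proof (rule borel_measurable_continuous_on[OF _ assms])
  have bl: "bounded_linear ((*v) A)" for A :: "real ^ 'n ^ 'k"
    by (rule matrix_vector_mul_bounded_linear)
  have le: "spectral_norm A \<le> spectral_norm B + norm (A - B)" for A B :: "real ^ 'n ^ 'k"
  proof -
    have "spectral_norm A \<le> spectral_norm B + spectral_norm (A - B)"
      using onorm_triangle[OF bl[of B] bl[of "A - B"]]
      by (simp add: spectral_norm_def matrix_vector_mult_add_rdistrib[symmetric])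
    moreover have "spectral_norm (A - B) \<le> norm (A - B)"
      unfolding spectral_norm_def by (rule onorm_bound) (auto intro: norm_matrix_vector_le)
    ultimately show ?thesis by simp
  qed
  have "\<bar>spectral_norm A - spectral_norm B\<bar> \<le> norm (A - B)" for A B :: "real ^ 'n ^ 'k"
    using le[of A B] le[of B A] by (simp add: norm_minus_commute abs_le_iff)
  then show "continuous_on UNIV (spectral_norm :: real ^ 'n ^ 'k \<Rightarrow> real)"
    unfolding continuous_on_iff dist_norm real_norm_def by (meson le_less_trans)
qed

section \<open>The Euler process as a function of its noise\<close>

text \<open>Along the Euler process the steps depend on the states, and hence on all earlier noise.  Expressing
  everything as a function of the sequence of increments makes the dependence on the past explicit,
  so that independence of the increments can be applied.\<close>

definition noise_F ::
    "(real \<Rightarrow> real ^ 'd \<Rightarrow> real ^ 'd) \<Rightarrow> (real \<Rightarrow> real ^ 'd \<Rightarrow> real ^ 'm ^ 'd) \<Rightarrow> real ^ 'd \<Rightarrow> (nat \<Rightarrow> real) \<Rightarrow>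
     (nat \<Rightarrow> real ^ 'm) \<Rightarrow> nat \<Rightarrow> real ^ 'd ^ 'd" where
  "noise_F b \<sigma> y s e i = mat 1 + step_error b \<sigma> (s i) (euler_state b \<sigma> y s e i) (s (Suc i) - s i) (e i)"

definition small :: "real \<Rightarrow> real ^ 'm \<Rightarrow> bool" where
  "small \<epsilon> \<xi> \<longleftrightarrow> (\<forall>l. \<bar>\<xi> $ l\<bar> \<le> \<epsilon>)"

definition noise_chain ::
    "(real \<Rightarrow> real ^ 'd \<Rightarrow> real ^ 'd) \<Rightarrow> (real \<Rightarrow> real ^ 'd \<Rightarrow> real ^ 'm ^ 'd) \<Rightarrow> real ^ 'd \<Rightarrow> (nat \<Rightarrow> real) \<Rightarrow>
     real \<Rightarrow> (nat \<Rightarrow> real ^ 'm) \<Rightarrow> nat \<Rightarrow> nat \<Rightarrow> real ^ 'd ^ 'd" where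
  "noise_chain b \<sigma> y s \<epsilon> e = inverse_chain (noise_F b \<sigma> y s e) (\<lambda>i. small \<epsilon> (e i))"

lemma euler_state_cong:
  "(\<And>i. i < j \<Longrightarrow> e i = e' i) \<Longrightarrow> euler_state b \<sigma> y s e j = euler_state b \<sigma> y s e' j"
  by (induction j) (simp_all add: Let_def)

lemma noise_chain_Suc:
  "noise_chain b \<sigma> y s \<epsilon> e k (Suc j) =
     (if j < k then mat 1
      else if small \<epsilon> (e j) then matrix_inv (noise_F b \<sigma> y s e j) ** noise_chain b \<sigma> y s \<epsilon> e k j
      else 0)"
  by (simp add: noise_chain_def)

lemma noise_chain_cong:
  assumes "\<And>i. i < j \<Longrightarrow> e i = e' i"
  shows "noise_chain b \<sigma> y s \<epsilon> e k j = noise_chain b \<sigma> y s \<epsilon> e' k j"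
  using assms
proof (induction j)
  case (Suc j)
  then have "euler_state b \<sigma> y s e j = euler_state b \<sigma> y s e' j"
    by (intro euler_state_cong) simp
  then have "noise_F b \<sigma> y s e j = noise_F b \<sigma> y s e' j"
    using Suc.prems by (simp add: noise_F_def)
  with Suc show ?case by (simp add: noise_chain_Suc)
qed (simp add: noise_chain_def)

locale euler_coefficients =
  fixes b :: "real \<Rightarrow> real ^ 'd \<Rightarrow> real ^ 'd" and \<sigma> :: "real \<Rightarrow> real ^ 'd \<Rightarrow> real ^ 'm ^ 'd"
    and L C q \<kappa> :: real
  assumes L: "L > 0" and \<kappa>: "\<kappa> > 0"
    and drift: "drift_condition L C q b" and diffusion: "diffusion_condition L C q \<kappa> \<sigma>"
begin

lemma C_on_b: "C_on (Suc 2) ({0..} \<times> UNIV) (\<lambda>(t, x). b t x)"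
  using drift unfolding drift_condition_def eval_nat_numeral by auto

lemma C_on_\<sigma>: "C_on (Suc 2) ({0..} \<times> UNIV) (\<lambda>(t, x). \<sigma> t x)"
  using diffusion unfolding diffusion_condition_def eval_nat_numeral by auto

lemma measurable_coefficients:
  assumes f: "f \<in> borel_measurable Q" and t: "0 \<le> t"
  shows "(\<lambda>\<omega>. b t (f \<omega>)) \<in> borel_measurable Q" "(\<lambda>\<omega>. \<sigma> t (f \<omega>)) \<in> borel_measurable Q"
    and "(\<lambda>\<omega>. partial_x i b t (f \<omega>)) \<in> borel_measurable Q"
    and "(\<lambda>\<omega>. partial_x i \<sigma> t (f \<omega>)) \<in> borel_measurable Q"
  using borel_measurable_continuous_on[OF _ f]
    C_on_continuous_space[OF C_on_b t] C_on_continuous_space[OF C_on_\<sigma> t]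
    continuous_on_partial_x[OF C_on_b t] continuous_on_partial_x[OF C_on_\<sigma> t]
  by blast+

lemma measurable_drift_jacobian:
  assumes f: "f \<in> borel_measurable Q" and t: "0 \<le> t"
  shows "(\<lambda>\<omega>. drift_jacobian b t (f \<omega>)) \<in> borel_measurable Q"
  unfolding drift_jacobian_def
  by (intro borel_measurable_vecI)
     (simp add: borel_measurable_vec_nth measurable_coefficients[OF f t])

lemma measurable_diffusion_jacobian:
  assumes f: "f \<in> borel_measurable Q" and t: "0 \<le> t"
  shows "(\<lambda>\<omega>. diffusion_jacobian \<sigma> l t (f \<omega>)) \<in> borel_measurable Q"
  unfolding diffusion_jacobian_def
  by (intro borel_measurable_vecI)
     (simp add: borel_measurable_vec_nth measurable_coefficients[OF f t])

lemma measurable_step_error: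
  assumes f: "f \<in> borel_measurable Q" and g: "g \<in> borel_measurable Q" and t: "0 \<le> t"
  shows "(\<lambda>\<omega>. step_error b \<sigma> t (f \<omega>) \<tau> (g \<omega>)) \<in> borel_measurable Q"
  unfolding step_error_def
  by (intro borel_measurable_add borel_measurable_sum borel_measurable_scaleR borel_measurable_const
      borel_measurable_vec_nth g measurable_drift_jacobian[OF f t] measurable_diffusion_jacobian[OF f t])

lemma measurable_grid_gram:
  assumes s: "\<And>i. 0 \<le> s i" and x: "\<And>i. (\<lambda>\<omega>. x \<omega> i) \<in> borel_measurable Q"
    and e: "\<And>i. (\<lambda>\<omega>. e \<omega> i) \<in> borel_measurable Q"
  shows "(\<lambda>\<omega>. grid_gram b \<sigma> s (x \<omega>) (e \<omega>) n) \<in> borel_measurable Q"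
proof (induction n)
  case 0
  show ?case by (simp add: grid_gram_def)
next
  case (Suc n)
  have F: "(\<lambda>\<omega>. mat 1 + step_error b \<sigma> (s n) (x \<omega> n) (s (Suc n) - s n) (e \<omega> n)) \<in> borel_measurable Q"
    by (intro borel_measurable_add borel_measurable_const measurable_step_error x e s)
  have A: "(\<lambda>\<omega>. diffusion_matrix \<sigma> (s n) (x \<omega> n)) \<in> borel_measurable Q"
    unfolding diffusion_matrix_def
    by (intro borel_measurable_matrix_mult borel_measurable_transpose measurable_coefficients x s)
  show ?case
    using borel_measurable_add[OF
        borel_measurable_matrix_mult[OF borel_measurable_matrix_mult[OF borel_measurable_transpose[OF F] Suc.IH] F]
        borel_measurable_scaleR[OF borel_measurable_const A]]
    by (simp add: grid_gram_def)
qed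

lemma measurable_euler_state:
  assumes s: "\<And>i. 0 \<le> s i" and e: "\<And>i. i < j \<Longrightarrow> (\<lambda>\<omega>. e \<omega> i) \<in> borel_measurable Q"
  shows "(\<lambda>\<omega>. euler_state b \<sigma> y s (e \<omega>) j) \<in> borel_measurable Q"
  using e
proof (induction j)
  case (Suc j)
  then have x: "(\<lambda>\<omega>. euler_state b \<sigma> y s (e \<omega>) j) \<in> borel_measurable Q" by simp
  show ?case
    unfolding euler_state.simps Let_def
    by (intro borel_measurable_add borel_measurable_scaleR borel_measurable_const x
        borel_measurable_matrix_vector_mult measurable_coefficients s Suc.prems) simp
qed simp

lemma measurable_small:
  assumes e: "(\<lambda>\<omega>. e \<omega>) \<in> borel_measurable Q"
  shows "{\<omega> \<in> space Q. small \<epsilon> (e \<omega>)} \<in> sets Q"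
proof -
  have "(\<lambda>\<omega>. e \<omega> $ l) \<in> borel_measurable Q" for l by (rule borel_measurable_vec_nth[OF e])
  then show ?thesis unfolding small_def by measurable
qed

lemma measurable_noise_chain:
  assumes s: "\<And>i. 0 \<le> s i" and e: "\<And>i. i < j \<Longrightarrow> (\<lambda>\<omega>. e \<omega> i) \<in> borel_measurable Q"
  shows "(\<lambda>\<omega>. noise_chain b \<sigma> y s \<epsilon> (e \<omega>) k j) \<in> borel_measurable Q"
  using e
proof (induction j)
  case 0
  show ?case by (simp add: noise_chain_def)
next
  case (Suc j)
  have x: "(\<lambda>\<omega>. euler_state b \<sigma> y s (e \<omega>) j) \<in> borel_measurable Q"
    using Suc.prems by (intro measurable_euler_state s) simp
  have F: "(\<lambda>\<omega>. noise_F b \<sigma> y s (e \<omega>) j) \<in> borel_measurable Q"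
    unfolding noise_F_def
    by (intro borel_measurable_add borel_measurable_const measurable_step_error x s Suc.prems) simp
  have IH: "(\<lambda>\<omega>. noise_chain b \<sigma> y s \<epsilon> (e \<omega>) k j) \<in> borel_measurable Q"
    using Suc by simp
  have "(\<lambda>\<omega>. if small \<epsilon> (e \<omega> j) then matrix_inv (noise_F b \<sigma> y s (e \<omega>) j) ** noise_chain b \<sigma> y s \<epsilon> (e \<omega>) k j
      else 0) \<in> borel_measurable Q"
    by (intro measurable_If borel_measurable_matrix_mult borel_measurable_matrix_inv F IH
        borel_measurable_const measurable_small Suc.prems) simp
  then show ?case by (cases "j < k") (simp_all add: noise_chain_Suc)
qed

definition jacobian_bound :: real where
  "jacobian_bound = real CARD('d) * real CARD('d) * L"

text \<open>Steps not longer than this, with increments not larger than this, have \<open>|E| \<le> 1 / 2\<close>.  It serves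
  both as the threshold \<open>\<epsilon>\<close> and as \<open>h\<^sub>0\<close>, and it is the same for all exponents.\<close>

definition cutoff :: real where
  "cutoff = min 1 (1 / (2 * jacobian_bound * (real CARD('m) + 1)))"

lemma jacobian_bound_pos: "0 < jacobian_bound"
  using L by (simp add: jacobian_bound_def)

lemma cutoff_pos: "0 < cutoff" and cutoff_le: "cutoff \<le> 1"
    "jacobian_bound * (real CARD('m) + 1) * cutoff \<le> 1 / 2"
proof -
  have c: "0 < 2 * jacobian_bound * (real CARD('m) + 1)"
    using jacobian_bound_pos by (intro mult_pos_pos) auto
  then show "0 < cutoff" by (simp add: cutoff_def)
  show "cutoff \<le> 1" by (simp add: cutoff_def)
  have "cutoff \<le> 1 / (2 * jacobian_bound * (real CARD('m) + 1))" by (simp add: cutoff_def)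
  then show "jacobian_bound * (real CARD('m) + 1) * cutoff \<le> 1 / 2"
    using c by (simp add: field_simps)
qed

lemma norm_step_error_le:
  assumes s: "0 \<le> s" and \<tau>: "0 \<le> \<tau>"
  shows "norm (step_error b \<sigma> s x \<tau> \<xi>) \<le> jacobian_bound * (\<tau> + (\<Sum>l\<in>UNIV. \<bar>\<xi> $ l\<bar>))"
proof -
  have "norm (step_error b \<sigma> s x \<tau> \<xi>) \<le> norm (\<tau> *\<^sub>R drift_jacobian b s x)
      + (\<Sum>l\<in>UNIV. norm (\<xi> $ l *\<^sub>R diffusion_jacobian \<sigma> l s x))"
    unfolding step_error_def by (intro norm_triangle_le add_left_mono norm_sum)
  also have "\<dots> \<le> \<tau> * jacobian_bound + (\<Sum>l\<in>UNIV. \<bar>\<xi> $ l\<bar> * jacobian_bound)"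
    using norm_drift_jacobian_le[OF drift s] norm_diffusion_jacobian_le[OF diffusion s] \<tau>
    by (intro add_mono sum_mono) (simp_all add: mult_left_mono jacobian_bound_def)
  finally show ?thesis by (simp add: sum_distrib_left algebra_simps)
qed

lemma norm_step_error_small:
  assumes s: "0 \<le> s" and \<tau>: "0 \<le> \<tau>" "\<tau> \<le> cutoff" and \<xi>: "small cutoff \<xi>"
  shows "norm (step_error b \<sigma> s x \<tau> \<xi>) \<le> 1 / 2"
proof -
  have "(\<Sum>l\<in>UNIV. \<bar>\<xi> $ l\<bar>) \<le> (\<Sum>l\<in>(UNIV :: 'm set). cutoff)"
    using \<xi> by (intro sum_mono) (simp add: small_def)
  then have "\<tau> + (\<Sum>l\<in>UNIV. \<bar>\<xi> $ l\<bar>) \<le> (real CARD('m) + 1) * cutoff"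
    using \<tau> by (simp add: algebra_simps)
  then have "jacobian_bound * (\<tau> + (\<Sum>l\<in>UNIV. \<bar>\<xi> $ l\<bar>)) \<le> jacobian_bound * ((real CARD('m) + 1) * cutoff)"
    using jacobian_bound_pos by (intro mult_left_mono) auto
  with norm_step_error_le[OF s \<tau>(1), of x \<xi>] cutoff_le(2) show ?thesis
    by (simp add: mult.assoc)
qed

text \<open>The three summands come from the quadratic remainder, from the drift, and from the steps at which
  the chain is set to \<open>0\<close>.\<close>

definition growth_rate :: "nat \<Rightarrow> real" where
  "growth_rate N = (36 * 6 ^ N + 12 * real N) * (2 * jacobian_bound\<^sup>2 * real CARD('m))
     + 2 * real N * jacobian_bound + real CARD('m) * (real N)\<^sup>2 * jacobian_bound\<^sup>2"

lemma growth_rate_nonneg: "0 \<le> growth_rate N"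
  using jacobian_bound_pos by (simp add: growth_rate_def)

text \<open>The coefficient of \<open>\<xi>\<^sub>l\<close> in the first-order expansion of \<open>|(1 + E)\<^sup>-\<^sup>1 X|\<^sup>2\<^sup>N\<close>.  It is a function of the past.\<close>

definition martingale_coeff :: "nat \<Rightarrow> real \<Rightarrow> real ^ 'd \<Rightarrow> real ^ 'd ^ 'd \<Rightarrow> 'm \<Rightarrow> real" where
  "martingale_coeff N s x X l =
     - 2 * real N * norm X ^ (2 * N - 2) * (X \<bullet> (diffusion_jacobian \<sigma> l s x ** X))"

lemma abs_inner_mult_le:
  fixes X B :: "real ^ 'd ^ 'd"
  assumes N: "N > 0" and B: "norm B \<le> c"
  shows "norm X ^ (2 * N - 2) * \<bar>X \<bullet> (B ** X)\<bar> \<le> c * norm X ^ (2 * N)"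
proof -
  have "\<bar>X \<bullet> (B ** X)\<bar> \<le> norm X * norm (B ** X)" by (rule Cauchy_Schwarz_ineq2)
  also have "\<dots> \<le> norm X * (norm B * norm X)" by (intro mult_left_mono norm_matrix_mult_le) simp
  also have "\<dots> \<le> norm X * (c * norm X)" using B by (intro mult_left_mono mult_right_mono) auto
  finally have "norm X ^ (2 * N - 2) * \<bar>X \<bullet> (B ** X)\<bar> \<le> norm X ^ (2 * N - 2) * (norm X * (c * norm X))"
    by (intro mult_left_mono) auto
  also have "\<dots> = c * norm X ^ (2 * N - 2 + 2)"
    by (simp only: power_add power2_eq_square) simp
  also have "2 * N - 2 + 2 = 2 * N" using N by simp
  finally show ?thesis .
qed

lemma abs_martingale_coeff_le:
  assumes "N > 0" "0 \<le> s"
  shows "\<bar>martingale_coeff N s x X l\<bar> \<le> 2 * real N * jacobian_bound * norm X ^ (2 * N)"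
proof -
  have "norm X ^ (2 * N - 2) * \<bar>X \<bullet> (diffusion_jacobian \<sigma> l s x ** X)\<bar> \<le> jacobian_bound * norm X ^ (2 * N)"
    using norm_diffusion_jacobian_le[OF diffusion assms(2)]
    by (intro abs_inner_mult_le assms) (simp add: jacobian_bound_def)
  from mult_left_mono[OF this, of "2 * real N"] show ?thesis
    by (simp add: martingale_coeff_def abs_mult mult_ac)
qed

text \<open>At a bad step the left side is \<open>0\<close>, and the right side has to be nonnegative although its linear
  term may be negative; completing the square in each \<open>\<xi>\<^sub>l\<close> shows that the quadratic term outweighs it.\<close>

lemma inverse_step_moment_le:
  fixes X :: "real ^ 'd ^ 'd" and x :: "real ^ 'd" and \<xi> :: "real ^ 'm"
  assumes N: "N > 0" and s: "0 \<le> s" and \<tau>: "0 \<le> \<tau>" "\<tau> \<le> cutoff"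
  defines "X' \<equiv> if small cutoff \<xi> then matrix_inv (mat 1 + step_error b \<sigma> s x \<tau> \<xi>) ** X else 0"
  shows "norm X' \<le> 2 * norm X"
    and "norm X' ^ (2 * N) \<le> norm X ^ (2 * N) * (1 + growth_rate N * (\<tau> + (\<Sum>l\<in>UNIV. (\<xi> $ l)\<^sup>2)))
      + (\<Sum>l\<in>UNIV. martingale_coeff N s x X l * \<xi> $ l)"
proof -
  let ?E = "step_error b \<sigma> s x \<tau> \<xi>"
  let ?m = "real CARD('m)"
  let ?c = jacobian_bound
  let ?S = "\<Sum>l\<in>UNIV. (\<xi> $ l)\<^sup>2"
  let ?z = "norm X ^ (2 * N)"
  let ?K1 = "36 * 6 ^ N + 12 * real N"
  have c: "0 \<le> ?c" using jacobian_bound_pos by simp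
  have m: "1 \<le> ?m" by (simp add: Suc_leI)
  have S: "0 \<le> ?S" by (simp add: sum_nonneg)
  have "norm X' \<le> 2 * norm X \<and> norm X' ^ (2 * N) \<le> ?z * (1 + growth_rate N * (\<tau> + ?S))
      + (\<Sum>l\<in>UNIV. martingale_coeff N s x X l * \<xi> $ l)"
  proof (cases "small cutoff \<xi>")
    case True
    define e where "e = norm ?E"
    have e: "0 \<le> e" "e \<le> 1 / 2"
      using norm_step_error_small[OF s \<tau> True] by (simp_all add: e_def)
    have inv: "invertible (mat 1 + ?E)" using e by (intro invertible_mat1_plus) (simp add: e_def)
    have "(mat 1 + ?E) ** X' = X"
      using True by (simp add: X'_def matrix_mul_assoc matrix_inv_mult[OF inv])
    then have eq: "X = X' + ?E ** X'"
      by (simp add: bounded_bilinear.add_left[OF bounded_bilinear_matrix_mult])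
    have lin: "norm (?E ** X' - ?E ** X) \<le> e * norm (X' - X)"
      using norm_matrix_mult_le[of ?E "X' - X"]
      by (simp add: bounded_bilinear.diff_right[OF bounded_bilinear_matrix_mult] e_def)
    note step = inverse_step_power_le[OF N e eq norm_matrix_mult_le[of ?E X', folded e_def]
        norm_matrix_mult_le[of ?E X, folded e_def] lin]
    have e2: "e\<^sup>2 \<le> 2 * ?c\<^sup>2 * ?m * (\<tau> + ?S)"
    proof -
      let ?a = "\<Sum>l\<in>UNIV. \<bar>\<xi> $ l\<bar>"
      have "e\<^sup>2 \<le> (?c * (\<tau> + ?a))\<^sup>2"
        using norm_step_error_le[OF s \<tau>(1), of x \<xi>] e by (intro power_mono) (auto simp: e_def)
      also have "\<dots> = ?c\<^sup>2 * (\<tau> + ?a)\<^sup>2" by (simp add: power_mult_distrib)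
      also have "\<dots> \<le> ?c\<^sup>2 * (2 * ?m * (\<tau> + ?S))"
      proof (rule mult_left_mono)
        have "\<tau> * \<tau> \<le> ?m * \<tau>" using \<tau> cutoff_le(1) m by (intro mult_right_mono) linarith+
        then have "\<tau>\<^sup>2 \<le> ?m * \<tau>" by (simp add: power2_eq_square)
        moreover have "?a\<^sup>2 \<le> ?m * ?S"
          using sum_squared_le_sum_of_squares[of "\<lambda>l. \<bar>\<xi> $ l\<bar>" UNIV] by (simp add: mult_ac)
        moreover have "(\<tau> + ?a)\<^sup>2 \<le> 2 * (\<tau>\<^sup>2 + ?a\<^sup>2)"
          using zero_le_power2[of "\<tau> - ?a"] by (simp add: power2_sum power2_diff)
        ultimately show "(\<tau> + ?a)\<^sup>2 \<le> 2 * ?m * (\<tau> + ?S)" by (simp add: distrib_left)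
      qed simp
      finally show ?thesis by (simp add: algebra_simps)
    qed
    have inner: "X \<bullet> (?E ** X) = \<tau> * (X \<bullet> (drift_jacobian b s x ** X))
        + (\<Sum>l\<in>UNIV. \<xi> $ l * (X \<bullet> (diffusion_jacobian \<sigma> l s x ** X)))"
      unfolding step_error_def
      by (simp add: bounded_bilinear.add_left[OF bounded_bilinear_matrix_mult]
          bounded_bilinear.sum_left[OF bounded_bilinear_matrix_mult]
          bounded_bilinear.scaleR_left[OF bounded_bilinear_matrix_mult] inner_add_right inner_sum_right)
    let ?A = "norm X ^ (2 * N - 2) * (X \<bullet> (drift_jacobian b s x ** X))"
    have "- (2 * real N * norm X ^ (2 * N - 2) * (X \<bullet> (?E ** X)))
        = 2 * real N * \<tau> * (- ?A) + (\<Sum>l\<in>UNIV. martingale_coeff N s x X l * \<xi> $ l)"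
      unfolding inner martingale_coeff_def by (simp add: sum_distrib_left sum_negf[symmetric] algebra_simps)
    moreover have "- ?A \<le> ?c * ?z"
    proof -
      have "norm X ^ (2 * N - 2) * \<bar>X \<bullet> (drift_jacobian b s x ** X)\<bar> \<le> ?c * ?z"
        using norm_drift_jacobian_le[OF drift s]
        by (intro abs_inner_mult_le N) (simp add: jacobian_bound_def)
      moreover have "- ?A \<le> norm X ^ (2 * N - 2) * \<bar>X \<bullet> (drift_jacobian b s x ** X)\<bar>"
        using mult_left_mono[OF abs_ge_minus_self[of "X \<bullet> (drift_jacobian b s x ** X)"], of "norm X ^ (2 * N - 2)"]
        by simp
      ultimately show ?thesis by linarith
    qed
    then have "2 * real N * \<tau> * (- ?A) \<le> 2 * real N * \<tau> * (?c * ?z)"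
      using \<tau> by (intro mult_left_mono) auto
    moreover have "?z * (?K1 * e\<^sup>2) \<le> ?z * (?K1 * (2 * ?c\<^sup>2 * ?m * (\<tau> + ?S)))"
      using e2 by (intro mult_left_mono) auto
    moreover have "?z * (2 * real N * \<tau> * ?c) \<le> ?z * (2 * real N * ?c * (\<tau> + ?S))"
      using S c by (intro mult_left_mono) (auto simp: algebra_simps)
    moreover have "0 \<le> ?z * (?m * (real N)\<^sup>2 * ?c\<^sup>2 * (\<tau> + ?S))" using S \<tau> by simp
    moreover have "?z * (1 + growth_rate N * (\<tau> + ?S)) = ?z + ?z * (?K1 * (2 * ?c\<^sup>2 * ?m * (\<tau> + ?S)))
        + ?z * (2 * real N * ?c * (\<tau> + ?S)) + ?z * (?m * (real N)\<^sup>2 * ?c\<^sup>2 * (\<tau> + ?S))"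
      unfolding growth_rate_def by (simp only: algebra_simps)
    moreover have "?z * (1 + ?K1 * e\<^sup>2) = ?z + ?z * (?K1 * e\<^sup>2)" by (simp only: distrib_left mult_1_right)
    moreover have "2 * real N * \<tau> * (?c * ?z) = ?z * (2 * real N * \<tau> * ?c)" by simp
    ultimately have "norm X' ^ (2 * N) \<le> ?z * (1 + growth_rate N * (\<tau> + ?S))
      + (\<Sum>l\<in>UNIV. martingale_coeff N s x X l * \<xi> $ l)"
      using step(2) by linarith
    with step(1) show ?thesis by simp
  next
    case False
    have "- (martingale_coeff N s x X l * \<xi> $ l) \<le> ?z * (1 / ?m + ?m * (real N)\<^sup>2 * ?c\<^sup>2 * (\<xi> $ l)\<^sup>2)" for l
    proof -
      have "- (martingale_coeff N s x X l * \<xi> $ l) \<le> \<bar>martingale_coeff N s x X l\<bar> * \<bar>\<xi> $ l\<bar>"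
        by (metis abs_ge_minus_self abs_mult)
      also have "\<dots> \<le> 2 * real N * ?c * ?z * \<bar>\<xi> $ l\<bar>"
        by (intro mult_right_mono abs_martingale_coeff_le N s) simp
      also have "\<dots> = ?z * (2 * (real N * ?c * \<bar>\<xi> $ l\<bar>))" by simp
      also have "\<dots> \<le> ?z * (1 / ?m + ?m * (real N)\<^sup>2 * ?c\<^sup>2 * (\<xi> $ l)\<^sup>2)"
      proof (rule mult_left_mono)
        have "0 \<le> (1 - ?m * (real N * ?c * \<bar>\<xi> $ l\<bar>))\<^sup>2 / ?m" by simp
        also have "\<dots> = 1 / ?m - 2 * (real N * ?c * \<bar>\<xi> $ l\<bar>) + ?m * (real N * ?c * \<bar>\<xi> $ l\<bar>)\<^sup>2"
          using m by (simp add: power2_eq_square field_simps)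
        finally show "2 * (real N * ?c * \<bar>\<xi> $ l\<bar>) \<le> 1 / ?m + ?m * (real N)\<^sup>2 * ?c\<^sup>2 * (\<xi> $ l)\<^sup>2"
          by (simp add: power_mult_distrib mult_ac)
      qed simp
      finally show ?thesis .
    qed
    then have "- (\<Sum>l\<in>UNIV. martingale_coeff N s x X l * \<xi> $ l)
        \<le> (\<Sum>l\<in>UNIV. ?z * (1 / ?m + ?m * (real N)\<^sup>2 * ?c\<^sup>2 * (\<xi> $ l)\<^sup>2))"
      unfolding sum_negf[symmetric] by (rule sum_mono)
    also have "\<dots> = ?z * (1 + ?m * (real N)\<^sup>2 * ?c\<^sup>2 * ?S)"
      by (simp add: sum.distrib sum_distrib_left[symmetric])
    also have "\<dots> \<le> ?z * (1 + growth_rate N * (\<tau> + ?S))"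
    proof -
      have "?m * (real N)\<^sup>2 * ?c\<^sup>2 * ?S \<le> growth_rate N * (\<tau> + ?S)"
        using \<tau> S c by (intro mult_mono) (auto simp: growth_rate_def)
      then show ?thesis by (intro mult_left_mono) auto
    qed
    finally show ?thesis using False N by (simp add: X'_def power_0_left)
  qed
  then show "norm X' \<le> 2 * norm X"
    and "norm X' ^ (2 * N) \<le> norm X ^ (2 * N) * (1 + growth_rate N * (\<tau> + (\<Sum>l\<in>UNIV. (\<xi> $ l)\<^sup>2)))
      + (\<Sum>l\<in>UNIV. martingale_coeff N s x X l * \<xi> $ l)" by blast+
qed

end

section \<open>Moments\<close>

definition normal_moment :: "nat \<Rightarrow> real" where
  "normal_moment k = fact (2 * k) / (2 ^ k * fact k)"

lemma normal_moment_nonneg: "0 \<le> normal_moment k"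
  by (simp add: normal_moment_def)

context prob_space
begin

lemma centred_normal_moments:
  assumes X: "distributed M lborel X (normal_density 0 (sqrt \<tau>))" and \<tau>: "0 < \<tau>"
  shows "integrable M X" "expectation X = 0"
    and "integrable M (\<lambda>\<omega>. X \<omega> ^ (2 * k))" "expectation (\<lambda>\<omega>. X \<omega> ^ (2 * k)) = normal_moment k * \<tau> ^ k"
proof -
  have s: "0 < sqrt \<tau>" using \<tau> by simp
  note odd = normal_moment_odd[OF s, of 0 0]
  note even = normal_moment_even[OF s, of 0 k]
  have nn: "0 \<le> normal_density 0 (sqrt \<tau>) x" for x by simp
  show "integrable M X"
    using distributed_integrable[OF X, of "\<lambda>x. x"] odd nn
    by (auto simp: has_bochner_integral_iff)
  show "expectation X = 0"
    using distributed_integral[OF X, of "\<lambda>x. x"] odd nn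
    by (auto simp: has_bochner_integral_iff)
  show "integrable M (\<lambda>\<omega>. X \<omega> ^ (2 * k))"
    using distributed_integrable[OF X, of "\<lambda>x. x ^ (2 * k)"] even nn
    by (auto simp: has_bochner_integral_iff)
  have "expectation (\<lambda>\<omega>. X \<omega> ^ (2 * k)) = fact (2 * k) / ((2 / (sqrt \<tau>)\<^sup>2) ^ k * fact k)"
    using distributed_integral[OF X, of "\<lambda>x. x ^ (2 * k)"] even nn
    by (auto simp: has_bochner_integral_iff)
  also have "\<dots> = normal_moment k * \<tau> ^ k"
    using \<tau> by (simp add: normal_moment_def power_divide)
  finally show "expectation (\<lambda>\<omega>. X \<omega> ^ (2 * k)) = normal_moment k * \<tau> ^ k" .
qed

text \<open>The function \<open>f\<close> is defined on whole sequences but looks only at the entries before \<open>j\<close>; this is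
  how adapted quantities are expressed here.\<close>

lemma expectation_past_times_present:
  fixes e :: "nat \<Rightarrow> 'a \<Rightarrow> 'b::topological_space" and f :: "(nat \<Rightarrow> 'b) \<Rightarrow> real" and g :: "'b \<Rightarrow> real"
  assumes indep: "indep_vars (\<lambda>_. borel) e {..<n}" and j: "j < n"
    and past: "\<And>w w'. (\<And>i. i < j \<Longrightarrow> w i = w' i) \<Longrightarrow> f w = f w'"
    and f: "f \<in> borel_measurable (PiM {..<j} (\<lambda>_. borel))" and g: "g \<in> borel_measurable borel"
    and int: "integrable M (\<lambda>\<omega>. f (\<lambda>i. e i \<omega>))" "integrable M (\<lambda>\<omega>. g (e j \<omega>))"
  shows "integrable M (\<lambda>\<omega>. f (\<lambda>i. e i \<omega>) * g (e j \<omega>))"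
    and "expectation (\<lambda>\<omega>. f (\<lambda>i. e i \<omega>) * g (e j \<omega>))
      = expectation (\<lambda>\<omega>. f (\<lambda>i. e i \<omega>)) * expectation (\<lambda>\<omega>. g (e j \<omega>))"
proof -
  have "indep_var (PiM {..<j} (\<lambda>_. borel)) (\<lambda>\<omega>. restrict (\<lambda>i. e i \<omega>) {..<j})
          (PiM {j} (\<lambda>_. borel)) (\<lambda>\<omega>. restrict (\<lambda>i. e i \<omega>) {j})"
    using j by (intro indep_var_restrict[OF indep]) auto
  moreover have "(\<lambda>w. g (w j)) \<in> borel_measurable (PiM {j} (\<lambda>_. borel))"
    by (rule measurable_compose[where f = "\<lambda>w. w j", OF measurable_component_singleton g]) simp
  ultimately have "indep_var borel (f \<circ> (\<lambda>\<omega>. restrict (\<lambda>i. e i \<omega>) {..<j}))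
      borel ((\<lambda>w. g (w j)) \<circ> (\<lambda>\<omega>. restrict (\<lambda>i. e i \<omega>) {j}))"
    using f by (intro indep_var_compose)
  moreover have "f (restrict (\<lambda>i. e i \<omega>) {..<j}) = f (\<lambda>i. e i \<omega>)" for \<omega>
    by (rule past) simp
  ultimately have "indep_var borel (\<lambda>\<omega>. f (\<lambda>i. e i \<omega>)) borel (\<lambda>\<omega>. g (e j \<omega>))"
    by (simp add: o_def)
  then show "integrable M (\<lambda>\<omega>. f (\<lambda>i. e i \<omega>) * g (e j \<omega>))"
    and "expectation (\<lambda>\<omega>. f (\<lambda>i. e i \<omega>) * g (e j \<omega>))
      = expectation (\<lambda>\<omega>. f (\<lambda>i. e i \<omega>)) * expectation (\<lambda>\<omega>. g (e j \<omega>))"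
    using int by (rule indep_var_integrable, rule indep_var_lebesgue_integral)
qed

end

context euler_coefficients
begin

definition chain_rate :: "nat \<Rightarrow> real" where
  "chain_rate N = growth_rate N * (1 + real CARD('m))"

definition large_step_const :: "nat \<Rightarrow> real" where
  "large_step_const N = (4 / \<kappa>) ^ N * real CARD('m) * normal_moment (Suc N) / cutoff ^ (2 * Suc N)"

lemma large_step_const_nonneg: "0 \<le> large_step_const N"
  using \<kappa> cutoff_pos normal_moment_nonneg[of "Suc N"] by (simp add: large_step_const_def)

definition inverse_moment_const :: "nat \<Rightarrow> real \<Rightarrow> real" where
  "inverse_moment_const N T = large_step_const N * T ^ Suc N
     + (1 / \<kappa>) ^ N * (norm (mat 1 :: real ^ 'd ^ 'd) ^ (2 * N) * exp (chain_rate N * T))"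

end

locale noisy_euler = euler_coefficients b \<sigma> L C q \<kappa> + prob_space M
  for b :: "real \<Rightarrow> real ^ 'd \<Rightarrow> real ^ 'd" and \<sigma> :: "real \<Rightarrow> real ^ 'd \<Rightarrow> real ^ 'm ^ 'd"
    and L C q \<kappa> :: real and M :: "'w measure" +
  fixes e :: "nat \<Rightarrow> 'w \<Rightarrow> real ^ 'm" and s :: "nat \<Rightarrow> real" and n :: nat and y :: "real ^ 'd"
  assumes s: "\<And>i. 0 \<le> s i"
    and step: "\<And>i. i < n \<Longrightarrow> s i < s (Suc i)" "\<And>i. i < n \<Longrightarrow> s (Suc i) - s i \<le> cutoff"
    and indep: "indep_vars (\<lambda>_. borel) e {..<n}"
    and normal: "\<And>i l. i < n \<Longrightarrow>
      distributed M lborel (\<lambda>\<omega>. e i \<omega> $ l) (normal_density 0 (sqrt (s (Suc i) - s i)))"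
begin

abbreviation chain :: "nat \<Rightarrow> nat \<Rightarrow> (nat \<Rightarrow> real ^ 'm) \<Rightarrow> real ^ 'd ^ 'd" where
  "chain k j w \<equiv> noise_chain b \<sigma> y s cutoff w k j"

lemma measurable_noise: "i < n \<Longrightarrow> e i \<in> borel_measurable M"
  using indep by (auto simp: indep_vars_def)

lemma measurable_chain: "j \<le> n \<Longrightarrow> (\<lambda>\<omega>. chain k j (\<lambda>i. e i \<omega>)) \<in> borel_measurable M"
  by (intro measurable_noise_chain s) (simp add: measurable_noise)

lemma measurable_chain_path: "chain k j \<in> borel_measurable (PiM {..<j} (\<lambda>_. borel))"
  by (intro measurable_noise_chain s) (simp add: measurable_component_singleton)

lemma chain_Suc:
  assumes "k \<le> j" shows "chain k (Suc j) w = (if small cutoff (w j)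
    then matrix_inv (mat 1 + step_error b \<sigma> (s j) (euler_state b \<sigma> y s w j) (s (Suc j) - s j) (w j)) ** chain k j w
    else 0)"
  using assms by (simp add: noise_chain_Suc noise_F_def)

text \<open>A crude bound, far too large in \<open>j\<close> for the moment estimate, but it makes all adapted quantities
  bounded and hence integrable.\<close>

lemma norm_chain_le: "k \<le> j \<Longrightarrow> j \<le> n \<Longrightarrow> norm (chain k j w) \<le> 2 ^ j * norm (mat 1 :: real ^ 'd ^ 'd)"
proof (induction j rule: dec_induct)
  case base
  have "1 * norm (mat 1 :: real ^ 'd ^ 'd) \<le> 2 ^ k * norm (mat 1 :: real ^ 'd ^ 'd)"
    by (intro mult_right_mono) auto
  then show ?case by (simp add: noise_chain_def inverse_chain_start)
next
  case (step j)
  then have "norm (chain k (Suc j) w) \<le> 2 * norm (chain k j w)"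
    using inverse_step_moment_le(1)[of 1 "s j" "s (Suc j) - s j"] s noisy_euler.step[OF noisy_euler_axioms, of j]
    by (simp add: chain_Suc[of k j w])
  also have "\<dots> \<le> 2 * (2 ^ j * norm (mat 1 :: real ^ 'd ^ 'd))" using step by simp
  finally show ?case by simp
qed

lemma integrable_bounded_noise:
  fixes f :: "'w \<Rightarrow> real"
  assumes "f \<in> borel_measurable M" "\<And>\<omega>. \<bar>f \<omega>\<bar> \<le> B"
  shows "integrable M f"
  using assms by (intro integrable_const_bound[of _ B]) auto

lemma integrable_chain: "k \<le> j \<Longrightarrow> j \<le> n \<Longrightarrow> integrable M (\<lambda>\<omega>. norm (chain k j (\<lambda>i. e i \<omega>)) ^ N)"
  by (rule integrable_bounded_noise[of _ "(2 ^ j * norm (mat 1 :: real ^ 'd ^ 'd)) ^ N"],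
      intro borel_measurable_power measurable_compose[OF _ borel_measurable_norm] measurable_chain)
     (simp_all add: power_mono norm_chain_le)

lemma normal_moment_1: "normal_moment (Suc 0) = 1"
  by (simp add: normal_moment_def fact_numeral)

text \<open>In the mean the martingale term vanishes, because its coefficients are independent of the
  centred increment, and \<open>|\<xi>|\<^sup>2\<close> contributes \<open>\<tau>\<close> for each component.\<close>

lemma chain_moment_step:
  assumes N: "N > 0" and k: "k \<le> j" and j: "j < n"
  shows "expectation (\<lambda>\<omega>. norm (chain k (Suc j) (\<lambda>i. e i \<omega>)) ^ (2 * N)) \<le>
    expectation (\<lambda>\<omega>. norm (chain k j (\<lambda>i. e i \<omega>)) ^ (2 * N)) * (1 + chain_rate N * (s (Suc j) - s j))"
proof -
  define \<tau> where "\<tau> = s (Suc j) - s j"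
  have \<tau>: "0 < \<tau>" "\<tau> \<le> cutoff" using step[OF j] by (simp_all add: \<tau>_def)
  let ?w = "\<lambda>\<omega> i. e i \<omega>"
  define Z where "Z = (\<lambda>w. norm (chain k j w) ^ (2 * N))"
  define \<gamma> where "\<gamma> = (\<lambda>l w. martingale_coeff N (s j) (euler_state b \<sigma> y s w j) (chain k j w) l)"
  define g where "g = (\<lambda>\<xi> :: real ^ 'm. 1 + growth_rate N * (\<tau> + (\<Sum>l\<in>UNIV. (\<xi> $ l)\<^sup>2)))"
  have Z_past: "Z w = Z w'" if "\<And>i. i < j \<Longrightarrow> w i = w' i" for w w'
  proof -
    have "chain k j w = chain k j w'" using that by (rule noise_chain_cong)
    then show ?thesis by (simp add: Z_def)
  qed
  have \<gamma>_past: "\<gamma> l w = \<gamma> l w'" if "\<And>i. i < j \<Longrightarrow> w i = w' i" for l w w'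
  proof -
    have "chain k j w = chain k j w'" "euler_state b \<sigma> y s w j = euler_state b \<sigma> y s w' j"
      using that by (auto intro: noise_chain_cong euler_state_cong)
    then show ?thesis by (simp add: \<gamma>_def)
  qed
  have \<gamma>_meas: "(\<lambda>\<omega>. \<gamma> l (v \<omega>)) \<in> borel_measurable Q"
    if "\<And>i. i < j \<Longrightarrow> (\<lambda>\<omega>. v \<omega> i) \<in> borel_measurable Q" for l v and Q :: "'z measure"
    unfolding \<gamma>_def martingale_coeff_def
    by (intro borel_measurable_times borel_measurable_const borel_measurable_power measurable_compose[OF _ borel_measurable_norm]
        borel_measurable_inner borel_measurable_matrix_mult measurable_diffusion_jacobian
        measurable_noise_chain measurable_euler_state s that)
  have \<gamma>_bound: "\<bar>\<gamma> l w\<bar> \<le> 2 * real N * jacobian_bound * (2 ^ j * norm (mat 1 :: real ^ 'd ^ 'd)) ^ (2 * N)" for l w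
  proof -
    have "\<bar>\<gamma> l w\<bar> \<le> 2 * real N * jacobian_bound * norm (chain k j w) ^ (2 * N)"
      unfolding \<gamma>_def by (rule abs_martingale_coeff_le[OF N s])
    also have "\<dots> \<le> 2 * real N * jacobian_bound * (2 ^ j * norm (mat 1 :: real ^ 'd ^ 'd)) ^ (2 * N)"
      using jacobian_bound_pos k j by (intro mult_left_mono power_mono norm_chain_le) auto
    finally show ?thesis .
  qed
  have \<gamma>_int: "integrable M (\<lambda>\<omega>. \<gamma> l (?w \<omega>))" for l
    using j by (intro integrable_bounded_noise[OF _ \<gamma>_bound] \<gamma>_meas) (simp add: measurable_noise)
  have Z_int: "integrable M (\<lambda>\<omega>. Z (?w \<omega>))"
    unfolding Z_def using k j by (intro integrable_chain) auto
  have Z_meas: "Z \<in> borel_measurable (PiM {..<j} (\<lambda>_. borel))"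
    unfolding Z_def by (intro borel_measurable_power measurable_compose[OF _ borel_measurable_norm] measurable_chain_path)
  note mom = centred_normal_moments[OF normal[OF j, folded \<tau>_def] \<tau>(1)]
  have sq_int: "integrable M (\<lambda>\<omega>. (e j \<omega> $ l)\<^sup>2)" and sq: "expectation (\<lambda>\<omega>. (e j \<omega> $ l)\<^sup>2) = \<tau>" for l
    using mom(3,4)[of l 1] by (simp_all add: normal_moment_1)
  have g_int: "integrable M (\<lambda>\<omega>. g (e j \<omega>))"
    unfolding g_def using sq_int by simp
  have g_exp: "expectation (\<lambda>\<omega>. g (e j \<omega>)) = 1 + chain_rate N * \<tau>"
    unfolding g_def using sq_int sq by (simp add: prob_space chain_rate_def algebra_simps)
  have g_meas: "g \<in> borel_measurable borel"
    unfolding g_def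
    by (intro borel_measurable_add borel_measurable_times borel_measurable_const borel_measurable_sum
        borel_measurable_power borel_measurable_vec_nth) simp_all
  note Zg = expectation_past_times_present[OF indep j Z_past Z_meas g_meas Z_int g_int]
  have \<gamma>\<xi>: "integrable M (\<lambda>\<omega>. \<gamma> l (?w \<omega>) * e j \<omega> $ l)" "expectation (\<lambda>\<omega>. \<gamma> l (?w \<omega>) * e j \<omega> $ l) = 0" for l
  proof -
    have past_meas: "\<gamma> l \<in> borel_measurable (PiM {..<j} (\<lambda>_. borel))"
      by (rule \<gamma>_meas) (simp add: measurable_component_singleton)
    have nth_meas: "(\<lambda>\<xi> :: real ^ 'm. \<xi> $ l) \<in> borel_measurable borel"
      by (rule borel_measurable_vec_nth) simp
    note * = expectation_past_times_present[OF indep j \<gamma>_past[of _ _ l] past_meas nth_meas \<gamma>_int mom(1)]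
    show "integrable M (\<lambda>\<omega>. \<gamma> l (?w \<omega>) * e j \<omega> $ l)" "expectation (\<lambda>\<omega>. \<gamma> l (?w \<omega>) * e j \<omega> $ l) = 0"
      using * mom(2)[of l] by simp_all
  qed
  have "expectation (\<lambda>\<omega>. norm (chain k (Suc j) (?w \<omega>)) ^ (2 * N))
      \<le> expectation (\<lambda>\<omega>. Z (?w \<omega>) * g (e j \<omega>) + (\<Sum>l\<in>UNIV. \<gamma> l (?w \<omega>) * e j \<omega> $ l))"
  proof (rule integral_mono)
    show "integrable M (\<lambda>\<omega>. norm (chain k (Suc j) (?w \<omega>)) ^ (2 * N))"
      using k j by (intro integrable_chain) auto
    show "integrable M (\<lambda>\<omega>. Z (?w \<omega>) * g (e j \<omega>) + (\<Sum>l\<in>UNIV. \<gamma> l (?w \<omega>) * e j \<omega> $ l))"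
      using Zg(1) \<gamma>\<xi>(1) by simp
    show "norm (chain k (Suc j) (?w \<omega>)) ^ (2 * N) \<le> Z (?w \<omega>) * g (e j \<omega>) + (\<Sum>l\<in>UNIV. \<gamma> l (?w \<omega>) * e j \<omega> $ l)" for \<omega>
      unfolding chain_Suc[OF k] Z_def g_def \<gamma>_def \<tau>_def
      using \<tau> by (intro inverse_step_moment_le(2) N s) (simp_all add: \<tau>_def)
  qed
  also have "\<dots> = expectation (\<lambda>\<omega>. Z (?w \<omega>)) * (1 + chain_rate N * \<tau>)"
    using Zg \<gamma>\<xi> by (simp add: g_exp)
  finally show ?thesis by (simp add: Z_def \<tau>_def)
qed

lemma chain_moment_le:
  assumes N: "N > 0" and k: "k \<le> j" and j: "j \<le> n"
  shows "expectation (\<lambda>\<omega>. norm (chain k j (\<lambda>i. e i \<omega>)) ^ (2 * N))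
    \<le> norm (mat 1 :: real ^ 'd ^ 'd) ^ (2 * N) * exp (chain_rate N * (s j - s k))"
  using k j
proof (induction j rule: dec_induct)
  case base
  show ?case by (simp add: noise_chain_def inverse_chain_start prob_space)
next
  case (step j)
  let ?D = "norm (mat 1 :: real ^ 'd ^ 'd) ^ (2 * N)"
  let ?\<tau> = "s (Suc j) - s j"
  have rate: "0 \<le> chain_rate N * ?\<tau>"
    using growth_rate_nonneg[of N] noisy_euler.step(1)[OF noisy_euler_axioms, of j] step.prems
    by (simp add: chain_rate_def)
  have "expectation (\<lambda>\<omega>. norm (chain k (Suc j) (\<lambda>i. e i \<omega>)) ^ (2 * N))
      \<le> expectation (\<lambda>\<omega>. norm (chain k j (\<lambda>i. e i \<omega>)) ^ (2 * N)) * (1 + chain_rate N * ?\<tau>)"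
    using step by (intro chain_moment_step N) auto
  also have "\<dots> \<le> ?D * exp (chain_rate N * (s j - s k)) * exp (chain_rate N * ?\<tau>)"
    using step rate exp_ge_add_one_self[of "chain_rate N * ?\<tau>"] by (intro mult_mono) auto
  also have "\<dots> = ?D * exp (chain_rate N * (s (Suc j) - s k))"
    by (simp add: mult_exp_exp distrib_left[symmetric] mult.assoc)
  finally show ?case .
qed

text \<open>Markov's inequality for the moment of order \<open>2 (N + 1)\<close>: it supplies \<open>\<tau>\<^sup>N\<^sup>+\<^sup>1\<close>, of which \<open>\<tau>\<^sup>N\<close> pays for
  the factor \<open>\<tau>\<^sup>-\<^sup>N\<close> and the remaining \<open>\<tau>\<close> makes the bounds summable over the grid.\<close>

lemma large_step_le:
  fixes N :: nat
  assumes k: "k < n"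
  defines "f \<equiv> \<lambda>\<omega>. if small cutoff (e k \<omega>) then 0 else (4 / (\<kappa> * (s (Suc k) - s k))) ^ N"
  shows "integrable M f" and "expectation f \<le> large_step_const N * (s (Suc k) - s k)"
proof -
  define \<tau> where "\<tau> = s (Suc k) - s k"
  have \<tau>: "0 < \<tau>" using step(1)[OF k] by (simp add: \<tau>_def)
  define c where "c = (4 / (\<kappa> * \<tau>)) ^ N"
  have c: "0 \<le> c" using \<kappa> \<tau> by (simp add: c_def)
  have f: "f = (\<lambda>\<omega>. if small cutoff (e k \<omega>) then 0 else c)"
    unfolding f_def c_def \<tau>_def ..
  show int: "integrable M f"
  proof (rule integrable_bounded_noise)
    show "f \<in> borel_measurable M"
      unfolding f by (intro measurable_If borel_measurable_const measurable_small measurable_noise k)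
    show "\<bar>f \<omega>\<bar> \<le> c" for \<omega> using c by (simp add: f)
  qed
  note mom = centred_normal_moments(3,4)[OF normal[OF k, folded \<tau>_def] \<tau>, where k = "Suc N"]
  have le: "f \<omega> \<le> c / cutoff ^ (2 * Suc N) * (\<Sum>l\<in>UNIV. (e k \<omega> $ l) ^ (2 * Suc N))" for \<omega>
  proof (cases "small cutoff (e k \<omega>)")
    case True
    then show ?thesis
      using c cutoff_pos unfolding f by (simp add: sum_nonneg zero_le_even_power del: power_Suc)
  next
    case False
    then obtain l where l: "cutoff < \<bar>e k \<omega> $ l\<bar>" by (auto simp: small_def not_le)
    then have "cutoff ^ (2 * Suc N) \<le> \<bar>e k \<omega> $ l\<bar> ^ (2 * Suc N)"
      using cutoff_pos by (intro power_mono) auto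
    also have "\<dots> = (e k \<omega> $ l) ^ (2 * Suc N)" by (rule power_even_abs) simp
    also have "\<dots> \<le> (\<Sum>l\<in>UNIV. (e k \<omega> $ l) ^ (2 * Suc N))"
      by (rule member_le_sum) (auto intro: zero_le_even_power simp del: power_Suc mult_Suc_right)
    finally have "c / cutoff ^ (2 * Suc N) * cutoff ^ (2 * Suc N)
        \<le> c / cutoff ^ (2 * Suc N) * (\<Sum>l\<in>UNIV. (e k \<omega> $ l) ^ (2 * Suc N))"
      using c cutoff_pos by (intro mult_left_mono) auto
    with False cutoff_pos show ?thesis unfolding f by simp
  qed
  have "expectation f \<le> expectation (\<lambda>\<omega>. c / cutoff ^ (2 * Suc N) * (\<Sum>l\<in>UNIV. (e k \<omega> $ l) ^ (2 * Suc N)))"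
    using int mom(1) by (intro integral_mono le) auto
  also have "\<dots> = c / cutoff ^ (2 * Suc N) * (real CARD('m) * (normal_moment (Suc N) * \<tau> ^ Suc N))"
    using mom by (simp del: power_Suc)
  also have "\<dots> = large_step_const N * \<tau>"
    using \<tau> by (simp add: large_step_const_def c_def power_divide power_mult_distrib field_simps)
  finally show "expectation f \<le> large_step_const N * (s (Suc k) - s k)" by (simp add: \<tau>_def)
qed

end

section \<open>The inverse Malliavin matrix\<close>

context noisy_euler
begin

text \<open>The states \<open>x\<close> agree with the function of the noise only almost surely, whereas integrability needs
  the given version to be measurable; hence both hypotheses.\<close>

lemma inverse_gram_moment_le:
  assumes N: "N > 0" and n: "n > 0" and T: "s n - s 0 \<le> T"
    and step_eq: "\<And>i. Suc i < n \<Longrightarrow> s (Suc i) - s i = h"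
    and x: "AE \<omega> in M. \<forall>i\<le>n. x \<omega> i = euler_state b \<sigma> y s (\<lambda>i. e i \<omega>) i"
    and meas: "(\<lambda>\<omega>. spectral_norm (matrix_inv (grid_gram b \<sigma> s (x \<omega>) (\<lambda>i. e i \<omega>) n))) \<in> borel_measurable M"
  defines "f \<equiv> \<lambda>\<omega>. spectral_norm (matrix_inv (grid_gram b \<sigma> s (x \<omega>) (\<lambda>i. e i \<omega>) n)) ^ N"
  shows "integrable M f" and "expectation f \<le> inverse_moment_const N T / (s n - s 0) ^ N"
proof -
  let ?\<tau> = "\<lambda>i. s (Suc i) - s i"
  let ?S = "s n - s 0"
  define bad where "bad = (\<lambda>k \<omega>. if small cutoff (e k \<omega>) then 0 else (4 / (\<kappa> * ?\<tau> k)) ^ N)"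
  define Z where "Z = (\<lambda>k \<omega>. norm (chain (Suc k) n (\<lambda>i. e i \<omega>)) ^ (2 * N))"
  define H where "H = (\<lambda>\<omega>. (\<Sum>k<n. bad k \<omega>) + (1 / \<kappa>) ^ N * (\<Sum>k<n. ?\<tau> k * Z k \<omega>) / ?S ^ Suc N)"
  have \<tau>: "0 < ?\<tau> i" if "i < n" for i using step(1)[OF that] by simp
  have S_eq: "(\<Sum>k<n. ?\<tau> k) = ?S" by (rule sum_lessThan_telescope)
  have S: "0 < ?S" unfolding S_eq[symmetric] using n \<tau> by (intro sum_pos) auto
  have bad_int: "integrable M (bad k)" and bad_le: "expectation (bad k) \<le> large_step_const N * ?\<tau> k"
    if "k < n" for k
    using large_step_le[OF that, of N] by (simp_all add: bad_def)
  have Z_int: "integrable M (Z k)" if "k < n" for k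
    unfolding Z_def using that by (intro integrable_chain) auto
  have Z_le: "expectation (Z k) \<le> norm (mat 1 :: real ^ 'd ^ 'd) ^ (2 * N) * exp (chain_rate N * T)"
    if k: "k < n" for k
  proof -
    have "s 0 \<le> s (Suc k)"
    proof -
      have "0 \<le> (\<Sum>i<Suc k. ?\<tau> i)" using \<tau> k by (intro sum_nonneg) (auto simp: less_imp_le)
      also have "\<dots> = s (Suc k) - s 0" by (rule sum_lessThan_telescope)
      finally show ?thesis by simp
    qed
    then have "chain_rate N * (s n - s (Suc k)) \<le> chain_rate N * T"
      using T growth_rate_nonneg[of N] by (intro mult_left_mono) (auto simp: chain_rate_def)
    then have "norm (mat 1 :: real ^ 'd ^ 'd) ^ (2 * N) * exp (chain_rate N * (s n - s (Suc k)))
        \<le> norm (mat 1 :: real ^ 'd ^ 'd) ^ (2 * N) * exp (chain_rate N * T)"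
      by (intro mult_left_mono) auto
    moreover have "expectation (Z k) \<le> norm (mat 1 :: real ^ 'd ^ 'd) ^ (2 * N) * exp (chain_rate N * (s n - s (Suc k)))"
      unfolding Z_def using k by (intro chain_moment_le N) auto
    ultimately show ?thesis by linarith
  qed
  have H_int: "integrable M H"
    unfolding H_def using bad_int Z_int
    by (intro Bochner_Integration.integrable_add Bochner_Integration.integrable_sum
        integrable_divide_zero integrable_mult_right) auto
  have H_le: "expectation H \<le> inverse_moment_const N T / ?S ^ N"
  proof -
    let ?D = "norm (mat 1 :: real ^ 'd ^ 'd) ^ (2 * N) * exp (chain_rate N * T)"
    have "expectation H = (\<Sum>k<n. expectation (bad k)) + (1 / \<kappa>) ^ N * (\<Sum>k<n. ?\<tau> k * expectation (Z k)) / ?S ^ Suc N"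
    proof -
      have "integrable M (\<lambda>\<omega>. \<Sum>k<n. bad k \<omega>)"
        and "integrable M (\<lambda>\<omega>. (1 / \<kappa>) ^ N * (\<Sum>k<n. ?\<tau> k * Z k \<omega>) / ?S ^ Suc N)"
        using bad_int Z_int
        by (intro Bochner_Integration.integrable_sum integrable_divide_zero integrable_mult_right; auto)+
      moreover have "expectation (\<lambda>\<omega>. \<Sum>k<n. bad k \<omega>) = (\<Sum>k<n. expectation (bad k))"
        using bad_int by (intro Bochner_Integration.integral_sum) auto
      moreover have "expectation (\<lambda>\<omega>. \<Sum>k<n. ?\<tau> k * Z k \<omega>) = (\<Sum>k<n. ?\<tau> k * expectation (Z k))"
        using Z_int by (subst Bochner_Integration.integral_sum) auto
      ultimately show ?thesis unfolding H_def by (simp del: power_Suc)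
    qed
    also have "\<dots> \<le> (\<Sum>k<n. large_step_const N * ?\<tau> k) + (1 / \<kappa>) ^ N * (\<Sum>k<n. ?\<tau> k * ?D) / ?S ^ Suc N"
      using bad_le Z_le \<tau> \<kappa> S
      by (intro add_mono sum_mono divide_right_mono mult_left_mono) (auto simp: less_imp_le)
    also have "\<dots> = large_step_const N * ?S + (1 / \<kappa>) ^ N * ?D / ?S ^ N"
      unfolding sum_distrib_left[symmetric] sum_distrib_right[symmetric] S_eq using S by simp
    also have "large_step_const N * ?S \<le> large_step_const N * (T ^ Suc N / ?S ^ N)"
    proof (rule mult_left_mono[OF _ large_step_const_nonneg])
      have "?S * ?S ^ N \<le> T ^ Suc N"
        using power_mono[OF T, of "Suc N"] S by simp
      then show "?S \<le> T ^ Suc N / ?S ^ N" using S by (simp add: field_simps)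
    qed
    finally show ?thesis
      unfolding inverse_moment_const_def add_divide_distrib by simp
  qed
  have f_le: "AE \<omega> in M. f \<omega> \<le> H \<omega>"
    using x
  proof eventually_elim
    case (elim \<omega>)
    let ?F = "\<lambda>i. mat 1 + step_error b \<sigma> (s i) (x \<omega> i) (?\<tau> i) (e i \<omega>)"
    let ?A = "\<lambda>i. diffusion_matrix \<sigma> (s i) (x \<omega> i)"
    have chain_eq: "inverse_chain ?F (\<lambda>i. small cutoff (e i \<omega>)) k j = chain k j (\<lambda>i. e i \<omega>)" if "j \<le> n" for k j
      using that
    proof (induction j)
      case (Suc j)
      then show ?case using elim by (simp add: noise_chain_Suc noise_F_def)
    qed (simp add: noise_chain_def)
    have "spectral_norm (matrix_inv (gram ?F ?A ?\<tau> n)) ^ N \<le>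
      (\<Sum>k<n. if small cutoff (e k \<omega>) then 0 else (4 / (\<kappa> * ?\<tau> k)) ^ N) +
      (1 / \<kappa>) ^ N * (\<Sum>k<n. ?\<tau> k * norm (inverse_chain ?F (\<lambda>i. small cutoff (e i \<omega>)) (Suc k) n) ^ (2 * N))
        / (\<Sum>k<n. ?\<tau> k) ^ Suc N"
    proof (rule gram_inverse_power_le(2)[OF \<kappa> n])
      show "0 < ?\<tau> i" if "i < n" for i by (rule \<tau>[OF that])
      show "?\<tau> i = h" if "Suc i < n" for i by (rule step_eq[OF that])
      show "\<kappa> * (norm v)\<^sup>2 \<le> v \<bullet> (?A i *v v)" if "i < n" for i v
        by (rule diffusion_matrix_elliptic[OF diffusion s])
      show "norm (?F i - mat 1) \<le> 1 / 2" if "i < n" "small cutoff (e i \<omega>)" for i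
        using norm_step_error_small[OF s _ _ that(2), of "?\<tau> i"] step[OF that(1)] by simp
    qed
    then show ?case
      unfolding f_def H_def grid_gram_def bad_def Z_def chain_eq[OF order_refl] S_eq .
  qed
  have f0: "0 \<le> f \<omega>" for \<omega>
    unfolding f_def spectral_norm_def by (intro zero_le_power onorm_pos_le matrix_vector_mul_bounded_linear)
  show f_int: "integrable M f"
  proof (rule Bochner_Integration.integrable_bound[OF H_int])
    show "f \<in> borel_measurable M" unfolding f_def by (intro borel_measurable_power meas)
    show "AE \<omega> in M. norm (f \<omega>) \<le> norm (H \<omega>)"
      using f_le by eventually_elim (use f0 in \<open>smt (verit) real_norm_def\<close>)
  qed
  have "expectation f \<le> expectation H" by (rule integral_mono_AE[OF f_int H_int f_le])
  with H_le show "expectation f \<le> inverse_moment_const N T / (s n - s 0) ^ N" by linarith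
qed

end

text \<open>Scaling by \<open>u\<close> first makes \<open>z\<^sup>p \<le> 1 + z\<^sup>N\<close> lose only a constant factor relative to \<open>u\<^sup>-\<^sup>p\<close>.\<close>

lemma (in prob_space) real_moment_le_natural_moment:
  fixes X :: "'a \<Rightarrow> real"
  assumes X: "X \<in> borel_measurable M" "\<And>\<omega>. 0 \<le> X \<omega>" and u: "0 < u" and p: "0 \<le> p" "p \<le> real N"
    and int: "integrable M (\<lambda>\<omega>. X \<omega> ^ N)" and le: "expectation (\<lambda>\<omega>. X \<omega> ^ N) \<le> K / u ^ N"
  shows "integrable M (\<lambda>\<omega>. X \<omega> powr p)" and "expectation (\<lambda>\<omega>. X \<omega> powr p) \<le> (1 + K) * u powr (- p)"
proof -
  have bound: "X \<omega> powr p \<le> u powr (- p) * (1 + u ^ N * X \<omega> ^ N)" for \<omega>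
  proof -
    have "(u * X \<omega>) powr p \<le> 1 + (u * X \<omega>) ^ N"
    proof (cases "u * X \<omega> \<le> 1")
      case True
      then have "(u * X \<omega>) powr p \<le> 1" using X(2) u p by (intro powr_le1) auto
      then show ?thesis using X(2) u by (simp add: add_increasing2)
    next
      case False
      then have "(u * X \<omega>) powr p \<le> (u * X \<omega>) powr real N" using p by (intro powr_mono) auto
      then show ?thesis using False by (simp add: powr_realpow)
    qed
    then have "u powr p * X \<omega> powr p \<le> 1 + u ^ N * X \<omega> ^ N"
      using X(2) u by (simp add: powr_mult power_mult_distrib)
    then show ?thesis using u by (simp add: powr_minus field_simps)
  qed
  have int': "integrable M (\<lambda>\<omega>. u powr (- p) * (1 + u ^ N * X \<omega> ^ N))" using int by simp
  show int_p: "integrable M (\<lambda>\<omega>. X \<omega> powr p)"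
  proof (rule Bochner_Integration.integrable_bound[OF int'])
    show "(\<lambda>\<omega>. X \<omega> powr p) \<in> borel_measurable M" using X(1) by measurable
    show "AE \<omega> in M. norm (X \<omega> powr p) \<le> norm (u powr (- p) * (1 + u ^ N * X \<omega> ^ N))"
      using bound by (intro AE_I2) (smt (verit) powr_ge_zero real_norm_def)
  qed
  have "expectation (\<lambda>\<omega>. X \<omega> powr p) \<le> expectation (\<lambda>\<omega>. u powr (- p) * (1 + u ^ N * X \<omega> ^ N))"
    by (rule integral_mono[OF int_p int' bound])
  also have "\<dots> = u powr (- p) * (1 + u ^ N * expectation (\<lambda>\<omega>. X \<omega> ^ N))"
    using int by (simp add: prob_space)
  also have "\<dots> \<le> u powr (- p) * (1 + u ^ N * (K / u ^ N))"
    using le u by (intro mult_left_mono add_left_mono) auto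
  finally show "expectation (\<lambda>\<omega>. X \<omega> powr p) \<le> (1 + K) * u powr (- p)" using u by (simp add: mult_ac)
qed

theorem theorem4p3:
  fixes M :: "'w measure"
    and W :: "real \<Rightarrow> 'w \<Rightarrow> real ^ 'm"
    and b :: "real \<Rightarrow> real ^ 'd \<Rightarrow> real ^ 'd"
    and \<sigma> :: "real \<Rightarrow> real ^ 'd \<Rightarrow> real ^ 'm ^ 'd"
    and L C q \<kappa> T :: real
  assumes "std_brownian_motion M W"
    and "T > 0"
    and "L > 0" and "C > 0" and "q \<ge> 0" and "\<kappa> > 0"
    and "drift_condition L C q b"
    and "diffusion_condition L C q \<kappa> \<sigma>"
  shows "\<exists>h0>0. \<forall>p>1. \<exists>K. \<forall>h m y Y t.
    0 < h \<and> h \<le> h0 \<and> euler_process M W b \<sigma> h m y Y \<and> real m * h < t \<and> t \<le> T \<longrightarrow>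
      (let G = (\<lambda>\<omega>. malliavin_matrix b \<sigma> h m (\<lambda>s. W s \<omega>) (\<lambda>s. Y s \<omega>) t) in
        (AE \<omega> in M. invertible (G \<omega>)) \<and>
        integrable M (\<lambda>\<omega>. spectral_norm (matrix_inv (G \<omega>)) powr p) \<and>
        prob_space.expectation M (\<lambda>\<omega>. spectral_norm (matrix_inv (G \<omega>)) powr p)
          \<le> K * (t - real m * h) powr (- p))"
proof -
  interpret euler_coefficients b \<sigma> L C q \<kappa>
    using assms by unfold_locales
  interpret prob_space M
    using assms(1) by (simp add: std_brownian_motion_def)
  have W_meas: "W t \<in> borel_measurable M" if "0 \<le> t" for t
    using assms(1) that by (simp add: std_brownian_motion_def)
  have W_indep: "indep_vars (\<lambda>_. borel) (\<lambda>i \<omega>. W (s (Suc i)) \<omega> - W (s i) \<omega>) {..<n}"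
    if "0 \<le> s 0" "mono s" for s :: "nat \<Rightarrow> real" and n
    using assms(1) that by (simp add: std_brownian_motion_def)
  have W_normal: "distributed M lborel (\<lambda>\<omega>. W t \<omega> $ l - W s \<omega> $ l) (normal_density 0 (sqrt (t - s)))"
    if "0 \<le> s" "s < t" for s t l
    using assms(1) that by (simp add: std_brownian_motion_def)
  have "\<exists>K. \<forall>h m y Y t.
    0 < h \<and> h \<le> cutoff \<and> euler_process M W b \<sigma> h m y Y \<and> real m * h < t \<and> t \<le> T \<longrightarrow>
      (let G = (\<lambda>\<omega>. malliavin_matrix b \<sigma> h m (\<lambda>s. W s \<omega>) (\<lambda>s. Y s \<omega>) t) in
        (AE \<omega> in M. invertible (G \<omega>)) \<and>
        integrable M (\<lambda>\<omega>. spectral_norm (matrix_inv (G \<omega>)) powr p) \<and>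
        expectation (\<lambda>\<omega>. spectral_norm (matrix_inv (G \<omega>)) powr p)
          \<le> K * (t - real m * h) powr (- p))" if p: "p > 1" for p
  proof -
    define N where "N = nat \<lceil>p\<rceil>"
    have N: "N > 0" "p \<le> real N" using p unfolding N_def by linarith+
    show ?thesis
    proof (rule exI[of _ "1 + inverse_moment_const N T"], intro allI impI, elim conjE)
      fix h t :: real and m :: nat and y :: "real ^ 'd" and Y :: "real \<Rightarrow> 'w \<Rightarrow> real ^ 'd"
      assume h: "0 < h" "h \<le> cutoff" and Y: "euler_process M W b \<sigma> h m y Y"
        and t: "real m * h < t" "t \<le> T"
      define s where "s = grid h m t"
      define n where "n = num_steps h m t"
      define e where "e = (\<lambda>i \<omega>. W (s (Suc i)) \<omega> - W (s i) \<omega>)"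
      note grid = grid_below[OF h(1) t(1), folded s_def n_def]
      have s: "0 \<le> s i" for i unfolding s_def by (rule grid_nonneg[OF h(1) t(1)])
      have n: "n > 0" unfolding n_def by (rule grid_num_steps(1)[OF h(1) t(1)])
      have sn: "s n - s 0 = t - real m * h"
        unfolding s_def n_def grid_num_steps(4)[OF h(1) t(1)] grid_0[OF h(1) t(1)] ..
      interpret noisy_euler b \<sigma> L C q \<kappa> M e s n y
      proof unfold_locales
        show "indep_vars (\<lambda>_. borel) e {..<n}"
          unfolding e_def using mono_grid[OF h(1)] s by (intro W_indep) (simp_all add: s_def)
        show "distributed M lborel (\<lambda>\<omega>. e i \<omega> $ l) (normal_density 0 (sqrt (s (Suc i) - s i)))"
          if "i < n" for i l
          using W_normal[OF s grid(2)[OF that]] by (simp add: e_def)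
        show "s (Suc i) - s i \<le> cutoff" if "i < n" for i
          using grid(3)[OF that] h(2) by linarith
      qed (use s grid(2) in auto)
      let ?x = "\<lambda>\<omega> i. Y (s i) \<omega>"
      let ?G = "\<lambda>\<omega>. grid_gram b \<sigma> s (?x \<omega>) (\<lambda>i. e i \<omega>) n"
      have G: "malliavin_matrix b \<sigma> h m (\<lambda>s. W s \<omega>) (\<lambda>s. Y s \<omega>) t = ?G \<omega>" for \<omega>
        unfolding malliavin_matrix_eq_gram[OF h(1) t(1)] s_def n_def e_def ..
      have x: "AE \<omega> in M. \<forall>i\<le>n. ?x \<omega> i = euler_state b \<sigma> y s (\<lambda>i. e i \<omega>) i"
      proof -
        have "AE \<omega> in M. euler_path b \<sigma> h m y (\<lambda>t. W t \<omega>) (\<lambda>t. Y t \<omega>)"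
          using Y by (simp add: euler_process_def)
        then show ?thesis
          by eventually_elim
             (use euler_path_eq_state[OF h(1) t(1)] in \<open>auto simp: s_def n_def e_def\<close>)
      qed
      have x_meas: "(\<lambda>\<omega>. ?x \<omega> i) \<in> borel_measurable M" for i
        using Y grid_ge[OF h(1) t(1)] by (simp add: euler_process_def s_def)
      have e_meas: "(\<lambda>\<omega>. e i \<omega>) \<in> borel_measurable M" for i
        unfolding e_def by (intro borel_measurable_diff W_meas s)
      have meas: "(\<lambda>\<omega>. spectral_norm (matrix_inv (?G \<omega>))) \<in> borel_measurable M"
        by (intro borel_measurable_spectral_norm borel_measurable_matrix_inv measurable_grid_gram s x_meas e_meas)
      have inv: "invertible (?G \<omega>)" for \<omega>
        unfolding grid_gram_def
      proof (rule gram_inverse_power_le(1)[where good = "\<lambda>i. small cutoff (e i \<omega>)" and h = h, OF \<kappa> n])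
        show "\<kappa> * (norm v)\<^sup>2 \<le> v \<bullet> (diffusion_matrix \<sigma> (s i) (?x \<omega> i) *v v)" for i v
          by (rule diffusion_matrix_elliptic[OF diffusion s])
        show "norm (mat 1 + step_error b \<sigma> (s i) (?x \<omega> i) (s (Suc i) - s i) (e i \<omega>) - mat 1) \<le> 1 / 2"
          if "i < n" "small cutoff (e i \<omega>)" for i
          using norm_step_error_small[OF s _ _ that(2), of "s (Suc i) - s i"] step[OF that(1)] by simp
      qed (use grid in auto)
      have "s n - s 0 \<le> T"
        using sn t(2) h(1) by (smt (verit) mult_nonneg_nonneg of_nat_0_le_iff)
      note moment = inverse_gram_moment_le[OF N(1) n this grid(4) x meas]
      have nonneg: "0 \<le> spectral_norm (matrix_inv (?G \<omega>))" for \<omega>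
        unfolding spectral_norm_def by (intro onorm_pos_le matrix_vector_mul_bounded_linear)
      have u: "0 < s n - s 0" using sn t(1) by simp
      have "0 \<le> p" using p by simp
      note real_moment_le_natural_moment[OF meas nonneg u this N(2) moment]
      then show "let G = (\<lambda>\<omega>. malliavin_matrix b \<sigma> h m (\<lambda>s. W s \<omega>) (\<lambda>s. Y s \<omega>) t) in
        (AE \<omega> in M. invertible (G \<omega>)) \<and>
        integrable M (\<lambda>\<omega>. spectral_norm (matrix_inv (G \<omega>)) powr p) \<and>
        expectation (\<lambda>\<omega>. spectral_norm (matrix_inv (G \<omega>)) powr p)
          \<le> (1 + inverse_moment_const N T) * (t - real m * h) powr (- p)"
        unfolding G Let_def sn using inv by simp
    qed
  qed
  then show ?thesis using cutoff_pos by blast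
qed

end
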